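(* Let $0<\lambda<1/e$ and $E(z)=\lambda e^z$. Let $x_0>\beta$ and let $\psi:[x_0,\infty)\to(0,\infty)$ be increasing with $\psi(x)\to\infty$, $\psi(2x)=O(\psi(x))$ and $\psi(x)=o(x)$ as $x\to\infty$. Put $\Omega_\psi=\{z\in\mathbb C:\operatorname{Re}z>x_0,\ |\operatorname{Im}z|<\psi(\operatorname{Re}z)\}$ and $\mathcal X=\mathcal X(x_0,\psi)=\{z\in\mathbb C:\operatorname{Re}E^k(z)>E^k(x_0)\text{ and }E^k(z)\in\Omega_\psi\text{ for all }k\in\mathbb N\}$. Let $h:(0,t_0)\to(0,\infty)$ be a gauge function of the form $h(t)=t/p(1/t)$, where $p:(1/t_0,\infty)\to(0,\infty)$ is increasing and $t\mapsto t\,p(1/t)$ is increasing, and let $\delta>0$. Then: (i) if $p\!\left(\frac{t(\log t)^{1+\delta}}{\psi(t)}\right)\le\psi(\log t)$ for all sufficiently large $t$, then $\mathcal H^h(\mathcal X)=\infty$; (ii) if $p\!\left(\frac{t\log t}{\psi(t)}\right)\ge(\log t)^{1+\delta}$ for all sufficiently large $t$, then $\mathcal H^h(\mathcal X)=0$.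
   Context: For $0<\lambda<1/e$, $E(z)=\lambda e^z$ has real fixed points $\alpha<1<\beta$, with $\beta$ repelling. $E^k$ denotes the $k$-th iterate. A gauge function is an increasing continuous $h:(0,t_0)\to(0,\infty)$ with $h(t)\to0$ as $t\to0$, and $\mathcal H^h(A)=\lim_{\delta\to0}\inf\sum_kh(\operatorname{diam}A_k)$, the infimum over countable covers of $A$ by sets of diameter $<\delta$. *)

theory Defs
  imports "HOL-Analysis.Analysis" "HOL-Library.Landau_Symbols"
begin

definition E_map :: "real \<Rightarrow> complex \<Rightarrow> complex" where
  "E_map lam z = complex_of_real lam * exp z"

definition Omega :: "real \<Rightarrow> (real \<Rightarrow> real) \<Rightarrow> complex set" where
  "Omega x0 psi = {z. Re z > x0 \<and> \<bar>Im z\<bar> < psi (Re z)}"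

definition Xset :: "real \<Rightarrow> real \<Rightarrow> (real \<Rightarrow> real) \<Rightarrow> complex set" where
  "Xset lam x0 psi = {z. \<forall>k::nat.
      Re ((E_map lam ^^ k) z) > Re ((E_map lam ^^ k) (complex_of_real x0))
    \<and> (E_map lam ^^ k) z \<in> Omega x0 psi}"

text \<open>Generalized Hausdorff measure with gauge h defined on (0,t0); h is extended
  by 0 at 0 (sets of diameter 0).  The limit as delta tends to 0 equals the supremum
  over delta in (0,t0), since the inner infimum is decreasing in delta.\<close>
definition gauge_hausdorff :: "(real \<Rightarrow> real) \<Rightarrow> real \<Rightarrow> 'a::metric_space set \<Rightarrow> ennreal" where
  "gauge_hausdorff h t0 A =
     (SUP \<delta>\<in>{0<..<t0}. INF C \<in> {C :: nat \<Rightarrow> 'a set.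
          A \<subseteq> (\<Union>k. C k) \<and> (\<forall>k. bounded (C k) \<and> diameter (C k) < \<delta>)}.
        (\<Sum>k. ennreal (if diameter (C k) = 0 then 0 else h (diameter (C k)))))"

end

theory Submission
  imports Defs "HOL-Real_Asymp.Real_Asymp"
begin

text \<open>
  Write \<open>e x = \<lambda> exp x\<close> and \<open>x\<^sub>j = e\<^sup>j(x)\<close>. Near real part \<open>x\<close>, the set splits into about \<open>\<psi>(x)\<close>
  horizontal strips, one for each branch of the logarithm; each of them splits again into about
  \<open>\<psi>(x\<^sub>1)\<close> strips, and so on. A strip of generation \<open>k\<close> has width about
  \<open>\<psi>(x\<^sub>k) / (x\<^sub>1 \<cdots> x\<^sub>k)\<close>, and there are about \<open>\<psi>(x) \<psi>(x\<^sub>1) \<cdots> \<psi>(x\<^sub>k\<^sub>-\<^sub>1)\<close> of them.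

  Covering these strips by squares of their width gives the upper estimate: since \<open>x\<^sub>k\<close> grows like an
  iterated exponential, the factor \<open>(log x\<^sub>k)\<^sup>1\<^sup>+\<^sup>\<delta>\<close> beats the number of strips. For the lower estimate,
  the branches are chosen independently and uniformly and \<open>x\<close> is distributed uniformly in an interval.
  A set of diameter \<open>d\<close> is pushed forward by \<open>E\<close> until its size exceeds \<open>1\<close>. It meets only one
  branch at each of these steps, so its mass is at most about
  \<open>d min (1, d/w) / (\<psi>(x) \<cdots> \<psi>(x\<^sub>k\<^sub>-\<^sub>1))\<close>, where \<open>w\<close> is the width of a strip of generation \<open>k\<close>. This is
  \<open>o(h(d))\<close>, and a finite subcover argument concludes. Only \<open>\<psi>(x) = o(x)\<close> is known, so the
  distortion constants multiply up to \<open>c\<^sup>k\<close>; both estimates leave room for such factors.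
\<close>

section \<open>The real exponential map and the branches of the logarithm\<close>

text \<open>No limit measure is constructed. Masses of finite generations are compared with a cover
  directly: its sets are made open, and finitely many of them contain all hairs from some generation
  on, because the closures of these hairs are nested compact sets whose intersection lies in the set
  studied. Hence the mass estimate must hold, for each diameter, in all late generations.

  The two arguments of \<open>p\<close> are bounds for reciprocal strip widths. With
  \<open>t = x_k\<close>, the product of \<open>x_1\<close> to \<open>x_(k-1)\<close> lies, up to
  constants, between \<open>ln t\<close> and its power \<open>1 + \<delta>\<close>, because the last
  factor dominates.

  Monotonicity of \<open>p\<close> treats diameters above the strip width, that of
  \<open>t * p (1 / t)\<close> those below. The latter also bounds \<open>h r\<close> by a multiple
  of \<open>h (s * r)\<close>, so enlarging covering sets by a constant factor costs only a
  constant.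

  Both estimates are proved for a large threshold \<open>a\<close>. An infinite value passes to
  \<open>x0\<close> by inclusion; a null set is pulled back by branches that are nonexpansive on the
  image, since the repelling fixed point lets the orbit of \<open>x0\<close> reach any
  threshold.\<close>

definition Er :: "real \<Rightarrow> real \<Rightarrow> real" where
  "Er lam x = lam * exp x"

text \<open>Only the values on the right half-plane matter. With \<open>0\<close> elsewhere the map
  is Borel on the whole plane, by continuity on an open half-plane that avoids the cut of
  \<open>Ln\<close>.\<close>

definition log_branch :: "real \<Rightarrow> int \<Rightarrow> complex \<Rightarrow> complex" where
  "log_branch lam n w =
    (if Re w > 0 then Ln (w / of_real lam) + of_real (2 * of_int n * pi) * \<i> else 0)"

lemma E_map_of_real: "E_map lam (of_real x) = of_real (Er lam x)"
  by (simp add: E_map_def Er_def exp_of_real)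

lemma E_map_funpow_of_real: "(E_map lam ^^ k) (of_real x) = of_real ((Er lam ^^ k) x)"
  by (induction k) (simp_all add: E_map_of_real)

lemma norm_E_map: "0 < lam \<Longrightarrow> norm (E_map lam z) = Er lam (Re z)"
  by (simp add: E_map_def Er_def norm_mult)

lemma Er_mono: "0 < lam \<Longrightarrow> x \<le> y \<Longrightarrow> Er lam x \<le> Er lam y"
  by (simp add: Er_def)

lemma Er_pos: "0 < lam \<Longrightarrow> 0 < Er lam x"
  by (simp add: Er_def)

lemma Er_add: "Er lam (x + y) = Er lam x * exp y"
  by (simp add: Er_def exp_add)

lemma ln_Er: "0 < lam \<Longrightarrow> ln (Er lam x) = ln lam + x"
  by (simp add: Er_def ln_mult)

lemma Xset_alt:
  "z \<in> Xset lam x0 psi \<longleftrightarrow> (\<forall>k. Re ((E_map lam ^^ k) z) > (Er lam ^^ k) x0 \<and>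
     Re ((E_map lam ^^ k) z) > x0 \<and> \<bar>Im ((E_map lam ^^ k) z)\<bar> < psi (Re ((E_map lam ^^ k) z)))"
  by (simp add: Xset_def Omega_def E_map_funpow_of_real)

lemma Xset_D:
  assumes "z \<in> Xset lam x0 psi"
  shows "Re z > x0" "\<bar>Im z\<bar> < psi (Re z)"
  using assms[unfolded Xset_alt, rule_format, of 0] by auto

lemma E_map_log_branch:
  assumes "0 < lam" "0 < Re w"
  shows "E_map lam (log_branch lam n w) = w"
proof -
  have "w \<noteq> 0" using assms by auto
  then show ?thesis
    using assms exp_plus_2pin[of "Ln (w / of_real lam)" n]
    by (simp add: log_branch_def E_map_def mult_ac)
qed

lemma Im_log_branch:
  assumes "0 < lam" "0 < Re w"
  shows "Im (log_branch lam n w) = Im (Ln w) + 2 * of_int n * pi"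
proof -
  have "w \<noteq> 0" using assms by auto
  then have "Ln (w / of_real lam) = Ln w - of_real (ln lam)"
    using Ln_divide_of_real[of lam w] assms by simp
  then show ?thesis using assms by (simp add: log_branch_def)
qed

lemma eq_log_branch:
  assumes "0 < lam" "0 < Re (E_map lam z)"
  obtains n where "z = log_branch lam n (E_map lam z)"
proof -
  have "exp z = exp (Ln (E_map lam z / of_real lam))"
    using assms by (simp add: E_map_def)
  then obtain n :: int where n: "z = Ln (E_map lam z / of_real lam) + of_real (2 * of_int n * pi) * \<i>"
    unfolding exp_eq of_int_mult of_int_numeral by blast
  have "z = log_branch lam n (E_map lam z)"
    unfolding log_branch_def if_P[OF assms(2)] by (rule n)
  then show ?thesis by (rule that)
qed

text \<open>The derivative is \<open>1 / w\<close>, of norm at most \<open>1 / c\<close> on a convex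
  half-plane. All contraction in both estimates comes from this bound.\<close>

lemma log_branch_lipschitz:
  assumes "0 < lam" "0 < c" "c \<le> Re v" "c \<le> Re w"
  shows "dist (log_branch lam n v) (log_branch lam n w) \<le> (1 / c) * dist v w"
proof -
  let ?S = "{z. c \<le> Re z}"
  have "norm (Ln (v / of_real lam) - Ln (w / of_real lam)) \<le> (1/c) * norm (v - w)"
  proof (rule field_differentiable_bound[where S = ?S and f' = "\<lambda>z. 1 / z"])
    show "convex ?S" using convex_halfspace_Re_ge[of c] by simp
    show "v \<in> ?S" "w \<in> ?S" using assms by auto
    fix z assume z: "z \<in> ?S"
    then have nz: "z \<noteq> 0" and nn: "z / of_real lam \<notin> \<real>\<^sub>\<le>\<^sub>0"
      using assms by (auto simp: complex_nonpos_Reals_iff divide_le_0_iff)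
    show "((\<lambda>a. Ln (a / of_real lam)) has_field_derivative 1 / z) (at z within ?S)"
      using nz nn assms by (auto intro!: derivative_eq_intros simp: field_simps)
    have "c \<le> norm z" using z complex_Re_le_cmod[of z] by simp
    then show "norm (1 / z) \<le> 1 / c" using assms by (simp add: norm_divide frac_le)
  qed
  then show ?thesis using assms by (simp add: log_branch_def dist_norm)
qed

lemma E_map_lipschitz:
  assumes "0 < lam" "Re v \<le> b" "Re w \<le> b"
  shows "dist (E_map lam v) (E_map lam w) \<le> Er lam b * dist v w"
  unfolding dist_norm
proof (rule field_differentiable_bound[where S = "{z. Re z \<le> b}" and f' = "E_map lam"])
  show "convex {z. Re z \<le> b}" using convex_halfspace_Re_le[of b] by simp
  fix z assume "z \<in> {z. Re z \<le> b}"
  then show "norm (E_map lam z) \<le> Er lam b" using assms by (simp add: norm_E_map Er_mono)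
  show "(E_map lam has_field_derivative E_map lam z) (at z within {z. Re z \<le> b})"
    unfolding E_map_def[abs_def] by (auto intro!: derivative_eq_intros)
qed (use assms in auto)

lemma Er_funpow_mono: "0 < lam \<Longrightarrow> x \<le> y \<Longrightarrow> (Er lam ^^ k) x \<le> (Er lam ^^ k) y"
  by (induction k) (auto intro: Er_mono)

text \<open>\<open>doubling\<close> starts at \<open>a / 2\<close> because it is also applied at
  \<open>y / 2\<close> for \<open>y\<close> at least \<open>a\<close>; \<open>ln_lam\<close> makes
  \<open>ln (Er lam x)\<close> comparable with \<open>x\<close>.\<close>

locale exp_strip =
  fixes lam a C :: real and psi :: "real \<Rightarrow> real"
  assumes lam_pos: "0 < lam" and lam_less: "lam < 1"
    and psi_mono: "mono psi"
    and C_ge: "1 \<le> C"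
    and a_ge: "8 \<le> a"
    and ln_lam: "- 2 * ln lam \<le> a"
    and psi_ge: "\<And>x. a / 2 \<le> x \<Longrightarrow> 8 \<le> psi x"
    and doubling: "\<And>x. a / 2 \<le> x \<Longrightarrow> psi (2 * x) \<le> C * psi x"
    and psi_small: "\<And>x. a \<le> x \<Longrightarrow> psi x \<le> x / 8"
    and Er_ge: "\<And>x. a \<le> x \<Longrightarrow> 2 * x \<le> Er lam x"
begin

lemma psi_le: "x \<le> y \<Longrightarrow> psi x \<le> psi y"
  using psi_mono by (rule monoD)

lemma psi_ge': "a \<le> x \<Longrightarrow> 8 \<le> psi x"
  using psi_ge[of x] a_ge by simp

lemma Er_ge_a: "a \<le> x \<Longrightarrow> a \<le> Er lam x"
  using Er_ge[of x] a_ge by simp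

lemma Er_funpow_ge: "a \<le> x \<Longrightarrow> a \<le> (Er lam ^^ k) x"
  by (induction k) (auto intro: Er_ge_a)

lemma ln_Er_bounds:
  assumes "a \<le> x" shows "x / 2 \<le> ln (Er lam x)" "ln (Er lam x) \<le> x"
proof -
  have "ln lam < 0" using lam_pos lam_less by simp
  then show "x / 2 \<le> ln (Er lam x)" "ln (Er lam x) \<le> x"
    using assms ln_lam by (auto simp: ln_Er lam_pos)
qed

end

lemma exp_strip_eventually:
  assumes lam: "0 < lam" "lam < 1" and mono: "mono psi" and pos: "\<And>x. 0 < psi x"
    and inf: "filterlim psi at_top at_top"
    and dbl: "(\<lambda>x. psi (2 * x)) \<in> O(psi)" and small: "psi \<in> o(\<lambda>x. x)"
  obtains C where "\<forall>\<^sub>F a in at_top. exp_strip lam a C psi"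
proof -
  obtain c where c: "\<forall>\<^sub>F x in at_top. norm (psi (2 * x)) \<le> c * norm (psi x)"
    using dbl by (auto elim!: landau_o.bigE)
  define C where "C = max 1 c"
  have 1: "\<forall>\<^sub>F x in at_top. psi (2 * x) \<le> C * psi x"
    using c
  proof eventually_elim
    case (elim x)
    have "psi (2*x) \<le> c * psi x" using elim pos by (simp add: less_imp_le)
    also have "\<dots> \<le> C * psi x" using pos[of x] by (intro mult_right_mono) (auto simp: C_def)
    finally show ?case .
  qed
  have 2: "\<forall>\<^sub>F x in at_top. 8 \<le> psi x" using inf by (auto simp: filterlim_at_top)
  have 3: "\<forall>\<^sub>F x in at_top. psi x \<le> x / 8"
    using landau_o.smallD[OF small, of "1/8"] eventually_ge_at_top[of 0]
    by (auto elim: eventually_elim2 simp: less_imp_le[OF pos] simp del: eventually_ge_at_top)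
  have "\<forall>\<^sub>F x :: real in at_top. x \<le> (lam / 2) * exp x"
  proof -
    have "((\<lambda>x::real. x / exp x) \<longlongrightarrow> 0) at_top"
      using tendsto_power_div_exp_0[of 1] by simp
    then have "\<forall>\<^sub>F x :: real in at_top. x / exp x < lam / 2"
      by (rule order_tendstoD) (use lam in simp)
    then show ?thesis by eventually_elim (simp add: field_simps)
  qed
  then have 4: "\<forall>\<^sub>F x in at_top. 2 * x \<le> Er lam x"
    by eventually_elim (simp add: Er_def)
  from 1 2 have "\<forall>\<^sub>F x in at_top. psi (2 * x) \<le> C * psi x \<and> 8 \<le> psi x" by (rule eventually_conj)
  then obtain A where A: "\<And>x. A \<le> x \<Longrightarrow> psi (2 * x) \<le> C * psi x \<and> 8 \<le> psi x"
    by (auto simp: eventually_at_top_linorder)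
  from 3 4 have "\<forall>\<^sub>F x in at_top. psi x \<le> x / 8 \<and> 2 * x \<le> Er lam x" by (rule eventually_conj)
  then obtain B where B: "\<And>x. B \<le> x \<Longrightarrow> psi x \<le> x / 8 \<and> 2 * x \<le> Er lam x"
    by (auto simp: eventually_at_top_linorder)
  \<comment> \<open>\<open>2 * A\<close> appears because two of the conditions are required from
    \<open>a / 2\<close> on.\<close>
  have "exp_strip lam a C psi" if "max (max 8 (- 2 * ln lam)) (max (2 * A) B) \<le> a" for a
    by unfold_locales (use lam mono that A B in \<open>auto simp: C_def\<close>)
  then show ?thesis using that eventually_at_top_linorder by blast
qed

section \<open>Null sets of the gauge measure\<close>

abbreviation gauge_term :: "(real \<Rightarrow> real) \<Rightarrow> 'a::metric_space set \<Rightarrow> ennreal" where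
  "gauge_term h A \<equiv> ennreal (if diameter A = 0 then 0 else h (diameter A))"

text \<open>Monotonicity of \<open>t * p (1 / t)\<close> gives
  \<open>s * p (1 / (s * r)) \<le> p (1 / r)\<close>; together with the factor \<open>s\<close> in
  the numerator of \<open>h (s * r)\<close> the loss is quadratic.\<close>

lemma gauge_scaling:
  fixes h p :: "real \<Rightarrow> real"
  assumes h_def: "\<forall>t\<in>{0<..<t0}. h t = t / p (1 / t)" and p_pos: "\<forall>s>1 / t0. p s > 0"
    and tp_mono: "mono_on {0<..<t0} (\<lambda>t. t * p (1 / t))"
    and r: "0 < r" "r < t0" and s: "0 < s" "s \<le> 1"
  shows "h r \<le> (1 / s^2) * h (s * r)"
proof -
  have t0: "0 < t0" using r by linarith
  have sr: "0 < s * r" "s * r \<le> r" using r s mult_right_mono[of s 1 r] by auto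
  then have "s * r < t0" using r by linarith
  note sr = sr this
  have pp: "0 < p (1 / r)" "0 < p (1 / (s * r))"
    using r sr t0 p_pos by (auto simp: frac_less2)
  have "s * r * p (1 / (s * r)) \<le> r * p (1 / r)"
    using mono_onD[OF tp_mono, of "s * r" r] r sr by simp
  then have "s * p (1 / (s * r)) \<le> p (1 / r)" using r by (simp add: mult.commute mult.left_commute)
  then have "r / p (1 / r) \<le> r / (s * p (1 / (s * r)))"
    using r s pp by (intro divide_left_mono) auto
  then show ?thesis using h_def r sr s by (simp add: power2_eq_square)
qed

lemma gauge_null_iff:
  "gauge_hausdorff h t0 A = 0 \<longleftrightarrow>
   (\<forall>\<delta>\<in>{0<..<t0}. \<forall>\<epsilon>>0. \<exists>C. A \<subseteq> (\<Union>k::nat. C k) \<and> (\<forall>k. bounded (C k) \<and> diameter (C k) < \<delta>) \<and>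
      (\<Sum>k. gauge_term h (C k)) \<le> ennreal \<epsilon>)" (is "_ \<longleftrightarrow> ?R")
proof -
  let ?Cs = "\<lambda>\<delta>. {C :: nat \<Rightarrow> 'a set. A \<subseteq> (\<Union>k. C k) \<and> (\<forall>k. bounded (C k) \<and> diameter (C k) < \<delta>)}"
  let ?f = "\<lambda>C. (\<Sum>k. gauge_term h (C k))"
  have "gauge_hausdorff h t0 A = 0 \<longleftrightarrow> (\<forall>\<delta>\<in>{0<..<t0}. (INF C \<in> ?Cs \<delta>. ?f C) = 0)"
    unfolding gauge_hausdorff_def bot_ennreal[symmetric] by (rule SUP_bot_conv(1))
  also have "\<dots> \<longleftrightarrow> (\<forall>\<delta>\<in>{0<..<t0}. \<forall>\<epsilon>>0. \<exists>C\<in>?Cs \<delta>. ?f C \<le> ennreal \<epsilon>)"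
  proof (intro ball_cong refl)
    fix \<delta>
    show "(INF C \<in> ?Cs \<delta>. ?f C) = 0 \<longleftrightarrow> (\<forall>\<epsilon>>0. \<exists>C\<in>?Cs \<delta>. ?f C \<le> ennreal \<epsilon>)" (is "?L \<longleftrightarrow> ?R'")
    proof
      assume L: ?L
      show ?R'
      proof (intro allI impI)
        fix \<epsilon> :: real assume "0 < \<epsilon>"
        then have "(INF C \<in> ?Cs \<delta>. ?f C) < ennreal \<epsilon>" using L by simp
        then show "\<exists>C\<in>?Cs \<delta>. ?f C \<le> ennreal \<epsilon>" unfolding INF_less_iff by (auto intro: less_imp_le)
      qed
    next
      assume R: ?R'
      have "(INF C \<in> ?Cs \<delta>. ?f C) \<le> 0 + ennreal \<epsilon>" if "0 < \<epsilon>" for \<epsilon>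
      proof -
        obtain C where "C \<in> ?Cs \<delta>" "?f C \<le> ennreal \<epsilon>" using R \<open>0 < \<epsilon>\<close> by blast
        then show ?thesis by (simp only: add_0) (rule INF_lower2)
      qed
      then show ?L using ennreal_le_epsilon[of 0 "INF C \<in> ?Cs \<delta>. ?f C"] unfolding le_zero_eq by blast
    qed
  qed
  finally show ?thesis unfolding Bex_def mem_Collect_eq conj_assoc .
qed

lemma gauge_null_subset:
  assumes "gauge_hausdorff h t0 B = 0" "A \<subseteq> B"
  shows "gauge_hausdorff h t0 A = 0"
  unfolding gauge_null_iff
proof (intro ballI allI impI)
  fix \<delta> \<epsilon> :: real assume "\<delta> \<in> {0<..<t0}" "0 < \<epsilon>"
  then obtain C where "B \<subseteq> (\<Union>k::nat. C k)" "\<forall>k. bounded (C k) \<and> diameter (C k) < \<delta>"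
      "(\<Sum>k. gauge_term h (C k)) \<le> ennreal \<epsilon>"
    using assms(1)[unfolded gauge_null_iff] by blast
  then show "\<exists>C. A \<subseteq> (\<Union>k::nat. C k) \<and> (\<forall>k. bounded (C k) \<and> diameter (C k) < \<delta>) \<and>
      (\<Sum>k. gauge_term h (C k)) \<le> ennreal \<epsilon>"
    using assms(2) by blast
qed

lemma gauge_null_UN:
  fixes A :: "nat \<Rightarrow> 'a::metric_space set"
  assumes "\<And>i. gauge_hausdorff h t0 (A i) = 0"
  shows "gauge_hausdorff h t0 (\<Union>i. A i) = 0"
  unfolding gauge_null_iff
proof (intro ballI allI impI)
  fix \<delta> \<epsilon> :: real assume d: "\<delta> \<in> {0<..<t0}" and e: "0 < \<epsilon>"
  let ?P = "\<lambda>i C. A i \<subseteq> (\<Union>k::nat. C k) \<and> (\<forall>k. bounded (C k) \<and> diameter (C k) < \<delta>) \<and>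
      (\<Sum>k. gauge_term h (C k)) \<le> ennreal (\<epsilon> * (1/2)^Suc i)"
  have "\<forall>i. \<exists>C. ?P i C"
  proof
    fix i
    have "0 < \<epsilon> * (1/2)^Suc i" using e by simp
    with d assms[of i, unfolded gauge_null_iff] show "\<exists>C. ?P i C" by blast
  qed
  from choice[OF this] obtain C where "\<forall>i. ?P i (C i)" ..
  then have C: "\<And>i. A i \<subseteq> (\<Union>k. C i k)"
      "\<And>i k. bounded (C i k) \<and> diameter (C i k) < \<delta>"
      "\<And>i. (\<Sum>k. gauge_term h (C i k)) \<le> ennreal (\<epsilon> * (1/2)^Suc i)"
    by blast+
  define D where "D = (\<lambda>m. case_prod C (prod_decode m))"
  have "(\<Sum>m. gauge_term h (D m)) = (\<Sum>i. \<Sum>k. gauge_term h (C i k))"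
  proof -
    define g where "g A = gauge_term h A" for A :: "'a set"
    have "(\<Sum>m. g (D m)) = (\<Sum>i. \<Sum>k. g (C i k))"
      using suminf_ennreal_2dimen[of "\<lambda>i. \<Sum>k. g (C i k)" "\<lambda>p. g (case_prod C p)"]
      by (simp add: D_def comp_def)
    then show ?thesis unfolding g_def .
  qed
  also have "\<dots> \<le> (\<Sum>i. ennreal (\<epsilon> * (1/2)^Suc i))" by (intro suminf_le C) auto
  also have "\<dots> = ennreal \<epsilon>"
    using sums_mult[OF power_half_series, of \<epsilon>] e
    by (intro suminf_ennreal_eq) (auto simp: mult_ac)
  finally have S: "(\<Sum>m. gauge_term h (D m)) \<le> ennreal \<epsilon>" .
  have "(\<Union>i. A i) \<subseteq> (\<Union>m. D m)"
  proof
    fix x assume "x \<in> (\<Union>i. A i)"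
    then obtain i k where "x \<in> C i k" using C(1) by blast
    then have "x \<in> D (prod_encode (i, k))" by (simp add: D_def)
    then show "x \<in> (\<Union>m. D m)" by blast
  qed
  moreover have "bounded (D m) \<and> diameter (D m) < \<delta>" for m
    using C(2) by (simp add: D_def split: prod.split)
  ultimately show "\<exists>C. (\<Union>i. A i) \<subseteq> (\<Union>k::nat. C k) \<and> (\<forall>k. bounded (C k) \<and> diameter (C k) < \<delta>) \<and>
      (\<Sum>k. gauge_term h (C k)) \<le> ennreal \<epsilon>" using S by blast
qed

lemma bounded_diameter_leI:
  fixes A :: "'a::metric_space set"
  assumes "\<And>x y. x \<in> A \<Longrightarrow> y \<in> A \<Longrightarrow> dist x y \<le> r" "0 \<le> r"
  shows "bounded A" "diameter A \<le> r"
proof -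
  show "bounded A" using assms(1) unfolding bounded_def by (metis equals0I)
  show "diameter A \<le> r" using assms unfolding diameter_def by (auto intro!: cSUP_least)
qed

text \<open>The trace of each covering set on \<open>A\<close> has an image of no larger diameter,
  so the mesh and the gauge sum both carry over.\<close>

lemma gauge_null_nonexpansive_image:
  fixes f :: "'a::metric_space \<Rightarrow> 'b::metric_space"
  assumes "gauge_hausdorff h t0 A = 0" and mono: "mono_on {0<..<t0} h"
    and lip: "\<And>x y. x \<in> A \<Longrightarrow> y \<in> A \<Longrightarrow> dist (f x) (f y) \<le> dist x y"
    and hpos: "\<And>t. t \<in> {0<..<t0} \<Longrightarrow> 0 \<le> h t"
  shows "gauge_hausdorff h t0 (f ` A) = 0"
  unfolding gauge_null_iff
proof (intro ballI allI impI)
  fix \<delta> \<epsilon> :: real assume d: "\<delta> \<in> {0<..<t0}" and e: "0 < \<epsilon>"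
  then obtain C where C: "A \<subseteq> (\<Union>k::nat. C k)" "\<And>k. bounded (C k) \<and> diameter (C k) < \<delta>"
      "(\<Sum>k. gauge_term h (C k)) \<le> ennreal \<epsilon>"
    using assms(1)[unfolded gauge_null_iff] by blast
  define D where "D k = f ` (A \<inter> C k)" for k
  have dist: "dist x y \<le> diameter (C k)" if xy: "x \<in> D k" "y \<in> D k" for x y k
  proof -
    obtain x' y' where "x' \<in> A \<inter> C k" "y' \<in> A \<inter> C k" "x = f x'" "y = f y'"
      using xy unfolding D_def by blast
    then show ?thesis using lip[of x' y'] diameter_bounded_bound[of "C k" x' y'] C(2)[of k] by auto
  qed
  have D: "bounded (D k)" "diameter (D k) \<le> diameter (C k)" for k
    using bounded_diameter_leI[of "D k" "diameter (C k)"] dist diameter_ge_0[of "C k"] C(2)[of k]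
    by blast+
  have "gauge_term h (D k) \<le> gauge_term h (C k)" for k
  proof (cases "diameter (D k) = 0")
    case False
    then have "0 < diameter (D k)" using diameter_ge_0[OF D(1)[of k]] by simp
    then have "h (diameter (D k)) \<le> h (diameter (C k))"
      using D[of k] C(2)[of k] d by (intro mono_onD[OF mono]) auto
    then show ?thesis using \<open>0 < diameter (D k)\<close> D(2)[of k] by (auto intro: ennreal_leI)
  qed simp
  then have "(\<Sum>k. gauge_term h (D k)) \<le> (\<Sum>k. gauge_term h (C k))" by (intro suminf_le) auto
  also note C(3)
  finally have "(\<Sum>k. gauge_term h (D k)) \<le> ennreal \<epsilon>" .
  moreover have "f ` A \<subseteq> (\<Union>k. D k)" using C(1) unfolding D_def by blast
  moreover have "bounded (D k) \<and> diameter (D k) < \<delta>" for k using D[of k] C(2)[of k] by auto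
  ultimately show "\<exists>C. f ` A \<subseteq> (\<Union>k::nat. C k) \<and> (\<forall>k. bounded (C k) \<and> diameter (C k) < \<delta>) \<and>
      (\<Sum>k. gauge_term h (C k)) \<le> ennreal \<epsilon>" by blast
qed

section \<open>Finite covers and their behaviour under inverse branches\<close>

text \<open>Each set carries a positive size bounding its diameter, and \<open>g\<close> is
  evaluated at that size: zero diameter needs no special case, and sizes can be rescaled. A list
  counts repeated sets with multiplicity.\<close>

definition finite_cover :: "(real \<Rightarrow> real) \<Rightarrow> real \<Rightarrow> 'a::metric_space set \<Rightarrow> real \<Rightarrow> bool" where
  "finite_cover g \<eta> Y S \<longleftrightarrow> (\<exists>xs :: ('a set \<times> real) list.
     Y \<subseteq> (\<Union>q\<in>set xs. fst q) \<and>
     (\<forall>q\<in>set xs. 0 < snd q \<and> snd q \<le> \<eta> \<and> (\<forall>x\<in>fst q. \<forall>y\<in>fst q. dist x y \<le> snd q)) \<and>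
     (\<Sum>q\<leftarrow>xs. g (snd q)) \<le> S)"

lemma finite_cover_single:
  assumes "\<And>x y. x \<in> Y \<Longrightarrow> y \<in> Y \<Longrightarrow> dist x y \<le> r" "0 < r" "r \<le> \<eta>" "g r \<le> S"
  shows "finite_cover g \<eta> Y S"
  unfolding finite_cover_def by (rule exI[of _ "[(Y, r)]"]) (use assms in auto)

lemma finite_cover_mono:
  assumes "finite_cover g \<eta> Y S" "Y' \<subseteq> Y" "\<eta> \<le> \<eta>'" "S \<le> S'"
  shows "finite_cover g \<eta>' Y' S'"
proof -
  obtain xs where "Y \<subseteq> (\<Union>q\<in>set xs. fst q)"
     "\<forall>q\<in>set xs. 0 < snd q \<and> snd q \<le> \<eta> \<and> (\<forall>x\<in>fst q. \<forall>y\<in>fst q. dist x y \<le> snd q)"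
     "(\<Sum>q\<leftarrow>xs. g (snd q)) \<le> S"
    using assms(1) unfolding finite_cover_def by blast
  then show ?thesis unfolding finite_cover_def using assms(2-)
    by (intro exI[of _ xs]) force
qed

lemma finite_cover_Un:
  assumes "finite_cover g \<eta> Y S" "finite_cover g \<eta> Y' S'"
  shows "finite_cover g \<eta> (Y \<union> Y') (S + S')"
proof -
  obtain xs where 1: "Y \<subseteq> (\<Union>q\<in>set xs. fst q)"
     "\<forall>q\<in>set xs. 0 < snd q \<and> snd q \<le> \<eta> \<and> (\<forall>x\<in>fst q. \<forall>y\<in>fst q. dist x y \<le> snd q)"
     "(\<Sum>q\<leftarrow>xs. g (snd q)) \<le> S"
    using assms(1) unfolding finite_cover_def by blast
  obtain ys where 2: "Y' \<subseteq> (\<Union>q\<in>set ys. fst q)"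
     "\<forall>q\<in>set ys. 0 < snd q \<and> snd q \<le> \<eta> \<and> (\<forall>x\<in>fst q. \<forall>y\<in>fst q. dist x y \<le> snd q)"
     "(\<Sum>q\<leftarrow>ys. g (snd q)) \<le> S'"
    using assms(2) unfolding finite_cover_def by blast
  have "\<forall>q\<in>set (xs @ ys). 0 < snd q \<and> snd q \<le> \<eta> \<and> (\<forall>x\<in>fst q. \<forall>y\<in>fst q. dist x y \<le> snd q)"
    using 1(2) 2(2) by auto
  moreover have "Y \<union> Y' \<subseteq> (\<Union>q\<in>set (xs @ ys). fst q)" using 1(1) 2(1) by auto
  moreover have "(\<Sum>q\<leftarrow>xs @ ys. g (snd q)) \<le> S + S'" using 1(3) 2(3) by simp
  ultimately show ?thesis unfolding finite_cover_def by blast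
qed

lemma finite_cover_UN:
  assumes "finite I" "\<And>i. i \<in> I \<Longrightarrow> finite_cover g \<eta> (Y i) S"
  shows "finite_cover g \<eta> (\<Union>i\<in>I. Y i) (real (card I) * S)"
  using assms
proof (induction I rule: finite_induct)
  case empty
  then show ?case by (auto simp: finite_cover_def intro: exI[of _ "[]"])
next
  case (insert i I)
  then have "finite_cover g \<eta> (Y i \<union> (\<Union>i\<in>I. Y i)) (S + real (card I) * S)"
    by (intro finite_cover_Un) auto
  then show ?case using insert by (simp add: algebra_simps)
qed

text \<open>Sizes shrink by \<open>c\<close> under \<open>f\<close>, so the cover of
  \<open>Z\<close> is measured in the rescaled gauge \<open>g (c * r)\<close>. This is why the
  inductive estimate below is stated for \<open>h (s * r)\<close> with \<open>s\<close>
  free.\<close>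

lemma finite_cover_lipschitz_image:
  assumes "finite_cover (\<lambda>r. g (c * r)) \<eta> Z S" "0 < c"
    and lip: "\<And>x y. x \<in> Z \<Longrightarrow> y \<in> Z \<Longrightarrow> dist (f x) (f y) \<le> c * dist x y"
  shows "finite_cover g (c * \<eta>) (f ` Z) S"
proof -
  obtain xs where xs: "Z \<subseteq> (\<Union>q\<in>set xs. fst q)"
     "\<forall>q\<in>set xs. 0 < snd q \<and> snd q \<le> \<eta> \<and> (\<forall>x\<in>fst q. \<forall>y\<in>fst q. dist x y \<le> snd q)"
     "(\<Sum>q\<leftarrow>xs. g (c * snd q)) \<le> S"
    using assms(1) unfolding finite_cover_def by blast
  define ys where "ys = map (\<lambda>q. (f ` (Z \<inter> fst q), c * snd q)) xs"
  have "f ` Z \<subseteq> (\<Union>q\<in>set ys. fst q)" using xs(1) by (fastforce simp: ys_def)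
  moreover have "0 < snd q \<and> snd q \<le> c * \<eta> \<and> (\<forall>x\<in>fst q. \<forall>y\<in>fst q. dist x y \<le> snd q)" if "q \<in> set ys" for q
  proof -
    obtain q' where q': "q' \<in> set xs" "q = (f ` (Z \<inter> fst q'), c * snd q')"
      using \<open>q \<in> set ys\<close> by (auto simp: ys_def)
    have "dist (f x) (f y) \<le> c * snd q'" if "x \<in> Z \<inter> fst q'" "y \<in> Z \<inter> fst q'" for x y
    proof -
      have "dist (f x) (f y) \<le> c * dist x y" using that lip by auto
      also have "\<dots> \<le> c * snd q'" using that q' xs(2) assms(2) by (intro mult_left_mono) auto
      finally show ?thesis .
    qed
    then show ?thesis using q' xs(2) assms(2) by auto
  qed
  moreover have "(\<Sum>q\<leftarrow>ys. g (snd q)) \<le> S" using xs(3) by (simp add: ys_def comp_def)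
  ultimately show ?thesis unfolding finite_cover_def by blast
qed

lemma gauge_null_if_finite_cover:
  assumes mono: "mono_on {0<..<t0} h"
    and cov: "\<And>\<eta> \<epsilon>. 0 < \<eta> \<Longrightarrow> 0 < \<epsilon> \<Longrightarrow> finite_cover h \<eta> Y \<epsilon>"
    and h_pos: "\<forall>t\<in>{0<..<t0}. h t > 0"
  shows "gauge_hausdorff h t0 Y = 0"
  unfolding gauge_null_iff
proof (intro ballI allI impI)
  fix \<delta> \<epsilon> :: real assume d: "\<delta> \<in> {0<..<t0}" and e: "0 < \<epsilon>"
  then obtain xs where xs: "Y \<subseteq> (\<Union>q\<in>set xs. fst q)"
     "\<forall>q\<in>set xs. 0 < snd q \<and> snd q \<le> \<delta>/2 \<and> (\<forall>x\<in>fst q. \<forall>y\<in>fst q. dist x y \<le> snd q)"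
     "(\<Sum>q\<leftarrow>xs. h (snd q)) \<le> \<epsilon>"
    using cov[of "\<delta>/2" \<epsilon>] unfolding finite_cover_def by auto
  define C where "C k = (if k < length xs then fst (xs ! k) else {})" for k
  have q: "0 < snd (xs ! k)" "snd (xs ! k) \<le> \<delta>/2"
    "\<And>x y. x \<in> C k \<Longrightarrow> y \<in> C k \<Longrightarrow> dist x y \<le> snd (xs ! k)" if "k < length xs" for k
    using xs(2)[THEN bspec, OF nth_mem[OF that]] that by (auto simp: C_def)
  have b: "bounded (C k)" "diameter (C k) \<le> snd (xs ! k)" if "k < length xs" for k
    using bounded_diameter_leI[OF q(3)[OF that] less_imp_le[OF q(1)[OF that]]] by auto
  have bd: "bounded (C k) \<and> diameter (C k) < \<delta>" for k
  proof (cases "k < length xs")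
    case True
    then show ?thesis using b[OF True] q(2)[OF True] d by auto
  next
    case False
    then show ?thesis using d by (simp add: C_def)
  qed
  have g: "gauge_term h (C k) \<le> ennreal (h (snd (xs ! k)))" if "k < length xs" for k
  proof (cases "diameter (C k) = 0")
    case False
    then have "0 < diameter (C k)" using diameter_ge_0[OF b(1)[OF that]] by linarith
    then have "h (diameter (C k)) \<le> h (snd (xs ! k))"
      using b(2)[OF that] q[OF that] d by (intro mono_onD[OF mono]) auto
    then show ?thesis using False by (auto intro: ennreal_leI)
  qed simp
  have hp: "0 \<le> h (snd (xs ! k))" if "k < length xs" for k
    using h_pos d q[OF that] by (auto intro!: less_imp_le)
  have "(\<Sum>k. gauge_term h (C k)) = (\<Sum>k<length xs. gauge_term h (C k))"
    by (rule suminf_finite) (auto simp: C_def)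
  also have "\<dots> \<le> (\<Sum>k<length xs. ennreal (h (snd (xs ! k))))" by (intro sum_mono g) auto
  also have "\<dots> = ennreal (\<Sum>k<length xs. h (snd (xs ! k)))" using hp by (intro sum_ennreal) auto
  also have "(\<Sum>k<length xs. h (snd (xs ! k))) = (\<Sum>q\<leftarrow>xs. h (snd q))"
    by (simp add: sum_list_sum_nth atLeast0LessThan)
  also have "ennreal \<dots> \<le> ennreal \<epsilon>" using xs(3) by (rule ennreal_leI)
  finally have S: "(\<Sum>k. gauge_term h (C k)) \<le> ennreal \<epsilon>" .
  have "Y \<subseteq> (\<Union>k. C k)"
  proof
    fix y assume "y \<in> Y"
    then obtain q where "q \<in> set xs" "y \<in> fst q" using xs(1) by blast
    then obtain k where "k < length xs" "y \<in> fst (xs ! k)" by (metis in_set_conv_nth)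
    then have "y \<in> C k" by (simp add: C_def)
    then show "y \<in> (\<Union>k. C k)" by blast
  qed
  then show "\<exists>C. Y \<subseteq> (\<Union>k::nat. C k) \<and> (\<forall>k. bounded (C k) \<and> diameter (C k) < \<delta>) \<and>
      (\<Sum>k. gauge_term h (C k)) \<le> ennreal \<epsilon>" using S bd by blast
qed

section \<open>The upper estimate\<close>

lemma E_map_funpow_Suc: "(E_map lam ^^ k) (E_map lam z) = (E_map lam ^^ Suc k) z"
  by (simp add: funpow_swap1)

section \<open>Behaviour of the sets under the map and its inverse branches\<close>

lemma Xset_antimono:
  assumes "0 < lam" "x \<le> y"
  shows "Xset lam y psi \<subseteq> Xset lam x psi"
proof
  fix z assume z: "z \<in> Xset lam y psi"
  show "z \<in> Xset lam x psi"
    unfolding Xset_alt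
  proof
    fix k
    show "Re ((E_map lam ^^ k) z) > (Er lam ^^ k) x \<and> Re ((E_map lam ^^ k) z) > x \<and>
        \<bar>Im ((E_map lam ^^ k) z)\<bar> < psi (Re ((E_map lam ^^ k) z))"
      using z[unfolded Xset_alt, rule_format, of k] Er_funpow_mono[OF assms, of k] assms(2) by auto
  qed
qed

lemma Xset_E_map:
  assumes "z \<in> Xset lam x0 psi" "0 < lam" "x0 \<le> Er lam x0"
  shows "E_map lam z \<in> Xset lam (Er lam x0) psi"
  unfolding Xset_alt
proof
  fix k
  have "x0 \<le> (Er lam ^^ k) x0"
  proof (induction k)
    case (Suc k)
    then show ?case using Er_mono[OF assms(2), of x0 "(Er lam ^^ k) x0"] assms(3) by simp
  qed simp
  then have "Er lam x0 \<le> (Er lam ^^ Suc k) x0" using Er_mono[OF assms(2)] by simp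
  then show "Re ((E_map lam ^^ k) (E_map lam z)) > (Er lam ^^ k) (Er lam x0) \<and>
     Re ((E_map lam ^^ k) (E_map lam z)) > Er lam x0 \<and>
     \<bar>Im ((E_map lam ^^ k) (E_map lam z))\<bar> < psi (Re ((E_map lam ^^ k) (E_map lam z)))"
    unfolding E_map_funpow_Suc
    using assms(1)[unfolded Xset_alt, rule_format, of "Suc k"] by (simp add: funpow_swap1)
qed

text \<open>Countably many branch images of the set with the larger threshold cover the set. Real
  parts there are at least 1, so the branches are nonexpansive.\<close>

lemma gauge_null_Xset_pullback:
  assumes null: "gauge_hausdorff h t0 (Xset lam (Er lam x) psi) = 0"
    and "0 < lam" "1 \<le> x" "x \<le> Er lam x"
    and mono: "mono_on {0<..<t0} h" and hpos: "\<forall>t\<in>{0<..<t0}. h t > 0"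
  shows "gauge_hausdorff h t0 (Xset lam x psi) = 0"
proof -
  let ?X = "Xset lam (Er lam x) psi"
  have "gauge_hausdorff h t0 (log_branch lam n ` ?X) = 0" for n
  proof (rule gauge_null_nonexpansive_image[OF null mono])
    fix v w assume "v \<in> ?X" "w \<in> ?X"
    then have "1 \<le> Re v" "1 \<le> Re w" using Xset_D(1) assms by force+
    then show "dist (log_branch lam n v) (log_branch lam n w) \<le> dist v w"
      using log_branch_lipschitz[of lam 1 v w n] assms by simp
  qed (use hpos in \<open>auto intro: less_imp_le\<close>)
  then have "gauge_hausdorff h t0 (\<Union>i::nat. log_branch lam (int_decode i) ` ?X) = 0"
    by (intro gauge_null_UN)
  moreover have "Xset lam x psi \<subseteq> (\<Union>i::nat. log_branch lam (int_decode i) ` ?X)"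
  proof
    fix z assume "z \<in> Xset lam x psi"
    then have z: "E_map lam z \<in> ?X" using assms by (intro Xset_E_map)
    then have "0 < Re (E_map lam z)" using Xset_D(1) assms by force
    then obtain n where "z = log_branch lam n (E_map lam z)" using eq_log_branch assms by blast
    then have "z \<in> log_branch lam (int_decode (int_encode n)) ` ?X" using z by auto
    then show "z \<in> (\<Union>i::nat. log_branch lam (int_decode i) ` ?X)" by blast
  qed
  ultimately show ?thesis by (rule gauge_null_subset)
qed

section \<open>Covers of the part of the set over a unit interval\<close>

context exp_strip
begin

abbreviation "slab u \<equiv> {z \<in> Xset lam a psi. u \<le> Re z \<and> Re z \<le> u + 1}"

lemma Er_add_1_le: "Er lam (u + 1) \<le> 3 * Er lam u"
proof -
  have "Er lam (u + 1) = Er lam u * exp 1" by (rule Er_add)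
  also have "\<dots> \<le> Er lam u * 3" using exp_le lam_pos by (intro mult_left_mono) (auto simp: Er_def)
  finally show ?thesis by simp
qed

text \<open>The modulus of the image lies between \<open>Er lam u\<close> and
  \<open>3 * Er lam u\<close>; as the imaginary part is below an eighth of the real part, the real
  part is at least half the modulus.\<close>

lemma slab_image:
  assumes "a \<le> u" "z \<in> slab u"
  shows "Er lam u / 2 \<le> Re (E_map lam z)" "Re (E_map lam z) \<le> 3 * Er lam u"
    "\<bar>Im (E_map lam z)\<bar> < psi (Re (E_map lam z))" "E_map lam z \<in> Xset lam a psi"
proof -
  let ?w = "E_map lam z"
  have "a \<le> Er lam a" using Er_ge_a by simp
  then have "?w \<in> Xset lam (Er lam a) psi" using assms lam_pos by (intro Xset_E_map) auto
  then show w: "?w \<in> Xset lam a psi" using Xset_antimono[OF lam_pos \<open>a \<le> Er lam a\<close>] by blast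
  then have re: "a < Re ?w" and im: "\<bar>Im ?w\<bar> < psi (Re ?w)" using Xset_D by auto
  then show "\<bar>Im ?w\<bar> < psi (Re ?w)" by simp
  have n: "norm ?w = Er lam (Re z)" using lam_pos by (rule norm_E_map)
  have "Er lam (Re z) \<le> Er lam (u + 1)" using assms lam_pos by (intro Er_mono) auto
  then show "Re ?w \<le> 3 * Er lam u" using complex_Re_le_cmod[of ?w] n Er_add_1_le[of u] by simp
  have "Er lam u \<le> Er lam (Re z)" using assms lam_pos by (intro Er_mono) auto
  also have "\<dots> \<le> \<bar>Re ?w\<bar> + \<bar>Im ?w\<bar>" using n cmod_le[of ?w] by simp
  also have "\<dots> \<le> 2 * Re ?w" using re im psi_small[of "Re ?w"] a_ge by simp
  finally show "Er lam u / 2 \<le> Re ?w" by simp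
qed

text \<open>Only about \<open>psi u\<close> branches can reach \<open>slab u\<close>, because of the
  bound on imaginary parts, and each is Lipschitz with constant \<open>2 / Er lam u\<close> on the
  image, where real parts are at least \<open>Er lam u / 2\<close>.\<close>

lemma finite_cover_preimage:
  assumes u: "a \<le> u" and I: "finite I" "E_map lam ` slab u \<subseteq> (\<Union>i\<in>I. Z i)"
    and cov: "\<And>i. i \<in> I \<Longrightarrow> finite_cover (\<lambda>r. g ((2 / Er lam u) * r)) \<eta> (Z i) S" and S: "0 \<le> S"
  shows "finite_cover g ((2 / Er lam u) * \<eta>) (slab u) (3 * C * psi u * (real (card I) * S))"
proof -
  define t where "t = Er lam u"
  have t: "0 < t" using lam_pos by (simp add: t_def Er_pos)
  define W where "W = E_map lam ` slab u"
  define N where "N = {- \<lfloor>C * psi u\<rfloor> .. \<lfloor>C * psi u\<rfloor>}"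
  have psi8: "8 \<le> C * psi u"
    using mult_mono[of 1 C 8 "psi u"] C_ge psi_ge'[OF u] by simp
  have "finite_cover (\<lambda>r. g ((2 / t) * r)) \<eta> (\<Union>i\<in>I. Z i) (real (card I) * S)"
    using I cov by (intro finite_cover_UN) (auto simp: t_def)
  then have W: "finite_cover (\<lambda>r. g ((2 / t) * r)) \<eta> W (real (card I) * S)"
    by (rule finite_cover_mono) (use I in \<open>auto simp: W_def\<close>)
  have Wre: "t / 2 \<le> Re w" if "w \<in> W" for w using that slab_image[OF u] by (auto simp: W_def t_def)
  have "finite_cover g ((2 / t) * \<eta>) (\<Union>n\<in>N. log_branch lam n ` W) (real (card N) * (real (card I) * S))"
  proof (rule finite_cover_UN)
    fix n
    show "finite_cover g ((2 / t) * \<eta>) (log_branch lam n ` W) (real (card I) * S)"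
    proof (rule finite_cover_lipschitz_image[OF W])
      show "0 < 2 / t" using t by simp
      fix v w assume "v \<in> W" "w \<in> W"
      then show "dist (log_branch lam n v) (log_branch lam n w) \<le> 2 / t * dist v w"
        using log_branch_lipschitz[of lam "t/2" v w n] lam_pos t Wre by simp
    qed
  qed (simp add: N_def)
  then have "finite_cover g ((2 / t) * \<eta>) (slab u) (3 * C * psi u * (real (card I) * S))"
  proof (rule finite_cover_mono)
    show "slab u \<subseteq> (\<Union>n\<in>N. log_branch lam n ` W)"
    proof
      fix z assume z: "z \<in> slab u"
      define w where "w = E_map lam z"
      have w: "w \<in> W" using z by (auto simp: W_def w_def)
      have rew: "0 < Re w" using Wre[OF w] t by simp
      then obtain n where n: "z = log_branch lam n w" using eq_log_branch lam_pos w_def by metis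
      have "\<bar>Im (Ln w)\<bar> < pi / 2" using rew by (rule Re_Ln_pos_lt_imp)
      moreover have "Im z = Im (Ln w) + 2 * of_int n * pi"
        unfolding n by (rule Im_log_branch[OF lam_pos rew])
      moreover have "\<bar>Im z\<bar> < psi (Re z)" using z Xset_D by blast
      moreover have "psi (Re z) \<le> psi (2 * u)" using z u a_ge by (intro psi_le) auto
      moreover have "psi (2 * u) \<le> C * psi u" using u a_ge by (intro doubling) auto
      moreover have "\<bar>2 * of_int n * pi\<bar> = 2 * pi * \<bar>real_of_int n\<bar>" by (simp add: abs_mult)
      ultimately have "2 * pi * \<bar>real_of_int n\<bar> < C * psi u + pi / 2" by linarith
      moreover have "2 * 3 * \<bar>real_of_int n\<bar> \<le> 2 * pi * \<bar>real_of_int n\<bar>"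
        using pi_gt3 by (intro mult_right_mono mult_left_mono) auto
      ultimately have "\<bar>real_of_int n\<bar> \<le> C * psi u" using psi8 pi_less_4 by linarith
      then have "n \<in> N" unfolding N_def by (auto simp: le_floor_iff) linarith
      then show "z \<in> (\<Union>n\<in>N. log_branch lam n ` W)" using n w by blast
    qed
    have "real (card N) = 2 * real_of_int \<lfloor>C * psi u\<rfloor> + 1"
      using psi8 unfolding N_def by (simp add: le_floor_iff)
    also have "\<dots> \<le> 3 * C * psi u" using psi8 of_int_floor_le[of "C * psi u"] by linarith
    finally show "real (card N) * (real (card I) * S) \<le> 3 * C * psi u * (real (card I) * S)"
      using S by (intro mult_right_mono) auto
  qed auto
  then show ?thesis by (simp add: t_def)
qed

text \<open>Used with \<open>l = psi t\<close> at the last generation, where pieces become roughly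
  square, and with \<open>l = 1\<close> before, where each piece lies in a slab again. The rounding
  in \<open>m\<close> is absorbed by \<open>1 \<le> t / l\<close>.\<close>

lemma slab_image_subset_pieces:
  assumes u: "a \<le> u" and l: "0 < l" "l \<le> Er lam u"
  defines "t \<equiv> Er lam u" and "m \<equiv> nat \<lceil>3 * Er lam u / l\<rceil>"
  shows "E_map lam ` slab u \<subseteq> (\<Union>i<m. {w \<in> E_map lam ` slab u. t/2 + real i * l \<le> Re w \<and> Re w \<le> t/2 + real i * l + l})"
    and "real m \<le> 4 * t / l" and "i < m \<Longrightarrow> real i * l \<le> 3 * t"
proof -
  have t: "0 < t" using lam_pos by (simp add: t_def Er_pos)
  have m: "real m = of_int \<lceil>3 * t / l\<rceil>" using t l by (simp add: m_def t_def)
  show "real m \<le> 4 * t / l"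
  proof -
    have "1 \<le> t / l" using l by (simp add: t_def)
    then show ?thesis using m by linarith
  qed
  show "real i * l \<le> 3 * t" if "i < m"
  proof -
    have "real i \<le> 3 * t / l" using that m by linarith
    then show ?thesis using l by (simp add: field_simps)
  qed
  show "E_map lam ` slab u \<subseteq> (\<Union>i<m. {w \<in> E_map lam ` slab u. t/2 + real i * l \<le> Re w \<and> Re w \<le> t/2 + real i * l + l})"
  proof
    fix w assume w: "w \<in> E_map lam ` slab u"
    then have re: "t/2 \<le> Re w" "Re w \<le> 3 * t" using slab_image[OF u] by (auto simp: t_def)
    define i where "i = nat \<lfloor>(Re w - t/2) / l\<rfloor>"
    have i: "real i = of_int \<lfloor>(Re w - t/2) / l\<rfloor>" using re l by (simp add: i_def)
    have "real i \<le> (Re w - t/2) / l" "(Re w - t/2) / l \<le> real i + 1" unfolding i by linarith+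
    then have 1: "real i * l \<le> Re w - t/2" "Re w - t/2 \<le> real i * l + l"
      using l by (auto simp: field_simps)
    have "(Re w - t/2) / l < 3 * t / l" using re t l by (intro divide_strict_right_mono) auto
    then have "real i < real m" unfolding i m by linarith
    then show "w \<in> (\<Union>i<m. {w \<in> E_map lam ` slab u. t/2 + real i * l \<le> Re w \<and> Re w \<le> t/2 + real i * l + l})"
      using 1 w by (auto intro!: bexI[of _ i])
  qed
qed

text \<open>The restriction \<open>s \<le> 1 / (C5 * u)\<close> is stable under the step from \<open>u\<close> to \<open>Er lam u\<close>, where \<open>s\<close> is
  replaced by \<open>2 s / Er lam u\<close>; at the last step it makes the argument of \<open>p\<close> at least \<open>t ln t / psi t\<close>.\<close>

lemma slab_cover:
  fixes h p :: "real \<Rightarrow> real" and t0 \<delta> K C5 :: real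
  assumes C5: "C5 = 2 * (1 + 2 * C^2)" and K: "K = 12 * C * C5 * 2 powr (1 + \<delta>)"
    and t0: "0 < t0" and \<delta>: "0 < \<delta>"
    and h_def: "\<forall>t\<in>{0<..<t0}. h t = t / p (1 / t)"
    and p_mono: "mono_on {1 / t0<..} p"
    and scale: "\<And>t. a \<le> t \<Longrightarrow> C5 * psi t / t \<le> 1/2 \<and> C5 * psi t / t < t0"
    and p_ge: "\<And>t. a \<le> t \<Longrightarrow> ln t powr (1 + \<delta>) \<le> p (t * ln t / psi t) \<and> 1 / t0 < t * ln t / psi t"
    and growth: "\<And>u. a \<le> u \<Longrightarrow> 48 * C * u powr (1 + \<delta>) \<le> (Er lam u / 2) powr \<delta>"
    and u: "a \<le> u" and s: "0 < s" "s \<le> 1 / (C5 * u)"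
  shows "finite_cover (\<lambda>r. h (s * r)) ((1/2) ^ Suc k) (slab u) (s * K * (1/2)^k * u powr - \<delta>)"
  using u s
proof (induction k arbitrary: u s)
  case 0
  note u = 0(1) and s = 0(2,3)
  define t where "t = Er lam u"
  have ta: "a \<le> t" using u by (simp add: t_def Er_ge_a)
  have t8: "8 \<le> t" using ta a_ge by simp
  have u8: "8 \<le> u" using u a_ge by simp
  have psit: "8 \<le> psi t" "psi t \<le> t / 8" using ta psi_ge' psi_small by auto
  have psiu: "8 \<le> psi u" "psi u \<le> u / 8" using u psi_ge' psi_small by auto
  have C5ge: "6 \<le> C5" using C_ge one_le_power[of C 2] by (simp add: C5)
  \<comment> \<open>The argument of \<open>h\<close> for a final square: a piece of diameter at most
    \<open>(1 + 2 * C^2) * psi t\<close>, contracted by \<open>2 / t\<close> and multiplied by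
    \<open>s\<close>.\<close>
  define y where "y = s * (C5 * psi t / t)"
  have y0: "0 < y" using s psit t8 C5ge by (simp add: y_def)
  have C5u: "1 \<le> C5 * u" using mult_mono[of 1 C5 1 u] C5ge u8 by simp
  have s1: "s \<le> 1" using s C5u by (meson dual_order.trans divide_le_eq_1_pos less_le_trans zero_less_one)
  have "y \<le> 1 * (C5 * psi t / t)" unfolding y_def using s1 psit t8 C5ge by (intro mult_right_mono) auto
  then have yt0: "y < t0" using scale[OF ta] by simp
  have lnt: "u / 2 \<le> ln t" "ln t \<le> u" using ln_Er_bounds[OF u] by (auto simp: t_def)
  have "t * ln t / psi t \<le> 1 / y"
  proof -
    have "s * (C5 * ln t) \<le> s * (C5 * u)" using s lnt C5ge by (intro mult_left_mono) auto
    also have "\<dots> \<le> 1" using s(2) C5u by (simp add: field_simps)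
    finally have "s * (C5 * ln t) \<le> 1" .
    then show ?thesis using psit t8 s C5ge by (simp add: y_def field_simps)
  qed
  then have "p (t * ln t / psi t) \<le> p (1 / y)"
    using p_ge[OF ta] by (intro mono_onD[OF p_mono]) auto
  moreover have "(u/2) powr (1 + \<delta>) \<le> ln t powr (1 + \<delta>)" using lnt \<delta> u8 by (intro powr_mono2) auto
  ultimately have pge: "(u/2) powr (1 + \<delta>) \<le> p (1 / y)" using p_ge[OF ta] by linarith
  have u2: "0 < (u/2) powr (1 + \<delta>)" using u8 by simp
  have hy: "h y = y / p (1 / y)" using h_def y0 yt0 by simp
  have ppos: "0 < p (1 / y)" using u2 pge by (rule less_le_trans)
  have hy0: "0 \<le> h y" unfolding hy using y0 ppos by (simp add: less_imp_le)
  have hyle: "h y \<le> y / (u/2) powr (1 + \<delta>)"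
    unfolding hy using y0 pge u2 ppos by (intro divide_left_mono mult_pos_pos) (auto simp: less_imp_le)
  define m where "m = nat \<lceil>3 * t / psi t\<rceil>"
  define Z where "Z i = {w \<in> E_map lam ` slab u. t/2 + real i * psi t \<le> Re w \<and> Re w \<le> t/2 + real i * psi t + psi t}" for i
  have pieces: "E_map lam ` slab u \<subseteq> (\<Union>i<m. Z i)" "real m \<le> 4 * t / psi t"
    using slab_image_subset_pieces(1,2)[OF u, of "psi t"] psit t8 by (auto simp: Z_def m_def t_def)
  have "finite_cover (\<lambda>r. h (s * r)) ((2 / Er lam u) * ((1 + 2 * C^2) * psi t)) (slab u)
          (3 * C * psi u * (real (card {..<m}) * h y))"
  proof (rule finite_cover_preimage[OF u])
    show "E_map lam ` slab u \<subseteq> (\<Union>i\<in>{..<m}. Z i)" using pieces by simp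
    fix i
    show "finite_cover (\<lambda>r. h (s * (2 / Er lam u * r))) ((1 + 2 * C^2) * psi t) (Z i) (h y)"
    proof (rule finite_cover_single)
      show "0 < (1 + 2 * C^2) * psi t" using psit by (simp add: add_pos_nonneg)
      show "h (s * (2 / Er lam u * ((1 + 2 * C^2) * psi t))) \<le> h y"
        by (simp add: y_def C5 t_def algebra_simps add_divide_distrib)
      \<comment> \<open>Real parts reach \<open>3 * t\<close>, below \<open>4 * t\<close>, so
        doubling is applied twice; hence the \<open>C^2\<close> in \<open>C5\<close>.\<close>
      have im: "\<bar>Im w\<bar> \<le> C^2 * psi t" if "w \<in> Z i" for w
      proof -
        have "w \<in> E_map lam ` slab u" using that by (simp add: Z_def)
        then have "\<bar>Im w\<bar> < psi (Re w)" "Re w \<le> 3 * t" using slab_image[OF u] by (auto simp: t_def)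
        then have "\<bar>Im w\<bar> \<le> psi (2 * (2 * t))" using psi_le[of "Re w" "2 * (2 * t)"] t8 by simp
        also have "\<dots> \<le> C * psi (2 * t)" using ta t8 by (intro doubling) auto
        also have "\<dots> \<le> C * (C * psi t)" using ta t8 C_ge by (intro mult_left_mono doubling) auto
        finally show ?thesis by (simp add: power2_eq_square mult_ac)
      qed
      fix v w assume vw: "v \<in> Z i" "w \<in> Z i"
      have "dist v w \<le> \<bar>Re (v - w)\<bar> + \<bar>Im (v - w)\<bar>" unfolding dist_norm by (rule cmod_le)
      also have "\<bar>Re (v - w)\<bar> \<le> psi t" using vw by (auto simp: Z_def)
      also have "\<bar>Im (v - w)\<bar> \<le> C^2 * psi t + C^2 * psi t" using im[OF vw(1)] im[OF vw(2)] unfolding minus_complex.sel by linarith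
      finally show "dist v w \<le> (1 + 2 * C^2) * psi t" by (simp add: algebra_simps)
    qed simp
  qed (use hy0 in auto)
  then show ?case
  proof (rule finite_cover_mono)
    have "2 / Er lam u * ((1 + 2 * C\<^sup>2) * psi t) = C5 * psi t / t"
      by (simp add: C5 t_def algebra_simps add_divide_distrib)
    then show "2 / Er lam u * ((1 + 2 * C\<^sup>2) * psi t) \<le> (1/2)^Suc 0"
      using scale[OF ta] by simp
    have "real m * h y \<le> (4 * t / psi t) * (y / (u/2) powr (1 + \<delta>))"
      using pieces(2) hyle hy0 psit t8 by (intro mult_mono) auto
    also have "\<dots> = 4 * C5 * s / (u/2) powr (1 + \<delta>)"
      using psit t8 by (simp add: y_def field_simps)
    \<comment> \<open>The number of branches is bounded only through \<open>psi u \<le> u\<close>;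
      the exponent \<open>1 + \<delta>\<close> still leaves \<open>u powr - \<delta>\<close>, and
      \<open>K\<close> collects the constants.\<close>
    finally have "3 * C * psi u * (real m * h y) \<le> 3 * C * u * (4 * C5 * s / (u/2) powr (1 + \<delta>))"
      using C_ge psiu hy0 by (intro mult_mono) auto
    also have "\<dots> = s * K * u powr - \<delta>"
      using u8 by (simp add: K powr_divide powr_minus powr_add field_simps)
    finally show "3 * C * psi u * (real (card {..<m}) * h y) \<le> s * K * (1/2)^0 * u powr - \<delta>" by simp
  qed simp
next
  case (Suc k)
  note u = Suc.prems(1) and s = Suc.prems(2,3)
  define t where "t = Er lam u"
  have t2u: "2 * u \<le> t" using u by (simp add: t_def Er_ge)
  have u8: "8 \<le> u" using u a_ge by simp
  have psiu: "8 \<le> psi u" "psi u \<le> u / 8" using u psi_ge' psi_small by auto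
  have C5ge: "6 \<le> C5" using C_ge one_le_power[of C 2] by (simp add: C5)
  have K0: "0 \<le> K" using C_ge C5ge by (simp add: K)
  define m where "m = nat \<lceil>3 * t / 1\<rceil>"
  \<comment> \<open>Going back one step contracts by \<open>2 / t\<close>; the scale of the gauge
    absorbs this.\<close>
  define s' where "s' = 2 * s / t"
  define S where "S = s' * K * (1/2)^k * (t/2) powr - \<delta>"
  have s'0: "0 < s'" using s t2u u8 by (simp add: s'_def)
  have S0: "0 \<le> S" using s'0 K0 by (simp add: S_def)
  define Z where "Z i = {w \<in> E_map lam ` slab u. t/2 + real i * 1 \<le> Re w \<and> Re w \<le> t/2 + real i * 1 + 1}" for i
  have pieces: "E_map lam ` slab u \<subseteq> (\<Union>i<m. Z i)" "real m \<le> 4 * t" "\<And>i. i < m \<Longrightarrow> real i \<le> 3 * t"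
    using slab_image_subset_pieces[OF u, of 1] t2u u8 by (auto simp: Z_def m_def t_def)
  have "finite_cover (\<lambda>r. h (s * r)) ((2 / Er lam u) * (1/2)^Suc k) (slab u)
          (3 * C * psi u * (real (card {..<m}) * S))"
  proof (rule finite_cover_preimage[OF u _ _ _ S0])
    show "E_map lam ` slab u \<subseteq> (\<Union>i\<in>{..<m}. Z i)" using pieces by simp
    fix i assume "i \<in> {..<m}"
    then have i: "real i \<le> 3 * t" using pieces(3) by simp
    define u' where "u' = t/2 + real i"
    have u': "a \<le> u'" "u' \<le> 4 * t" "t/2 \<le> u'" using t2u u u8 i by (auto simp: u'_def)
    have "s' \<le> 1 / (C5 * u')"
    proof -
      have "s * (C5 * u) \<le> 1" using s(2) C5ge u8 by (simp add: field_simps)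
      \<comment> \<open>\<open>8 \<le> u\<close> pays for the factor 2 in \<open>s'\<close> and for
        the range \<open>u' \<le> 4 * t\<close>.\<close>
      moreover have "s * (C5 * 8) \<le> s * (C5 * u)" using s C5ge u8 by (intro mult_left_mono) auto
      ultimately have "s * (C5 * 8) \<le> 1" by linarith
      then have "s' * (C5 * (4 * t)) \<le> 1" using t2u u8 by (simp add: s'_def field_simps)
      moreover have "s' * (C5 * u') \<le> s' * (C5 * (4 * t))"
        using s'0 C5ge u' by (intro mult_left_mono) auto
      ultimately have "s' * (C5 * u') \<le> 1" by linarith
      then show ?thesis using C5ge u' a_ge by (simp add: field_simps)
    qed
    then have "finite_cover (\<lambda>r. h (s' * r)) ((1/2)^Suc k) (slab u') (s' * K * (1/2)^k * u' powr - \<delta>)"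
      using Suc.IH u' s'0 by blast
    then have "finite_cover (\<lambda>r. h (s' * r)) ((1/2)^Suc k) (Z i) S"
    proof (rule finite_cover_mono)
      show "Z i \<subseteq> slab u'" using slab_image(4)[OF u] by (auto simp: Z_def u'_def)
      have "u' powr - \<delta> \<le> (t/2) powr - \<delta>" using u' t2u u8 \<delta> by (intro powr_mono2') auto
      then show "s' * K * (1/2)^k * u' powr - \<delta> \<le> S"
        unfolding S_def using s'0 K0 by (intro mult_left_mono) auto
    qed simp
    moreover have "(\<lambda>r. h (s * (2 / Er lam u * r))) = (\<lambda>r. h (s' * r))"
      by (simp add: s'_def t_def mult_ac)
    ultimately show "finite_cover (\<lambda>r. h (s * (2 / Er lam u * r))) ((1/2)^Suc k) (Z i) S" by simp
  qed simp
  then show ?case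
  proof (rule finite_cover_mono)
    have "2 / t \<le> 1/2" using t2u u8 by (simp add: field_simps)
    then have "2 / t * (1/2)^Suc k \<le> 1/2 * (1/2)^Suc k" by (rule mult_right_mono) simp
    then show "2 / Er lam u * (1/2)^Suc k \<le> (1/2)^Suc (Suc k)" by (simp add: t_def)
    have "48 * C * u powr (1 + \<delta>) \<le> (t/2) powr \<delta>" using growth[OF u] by (simp add: t_def)
    then have "48 * C * u * u powr \<delta> \<le> (t/2) powr \<delta>" using u8 by (simp add: powr_add)
    \<comment> \<open>A generation costs a factor \<open>24 * C * u\<close>, but the negative power
      is now taken at \<open>t / 2\<close>, exponentially large in \<open>u\<close>; the net gain is
      the factor 1/2.\<close>
    then have gr: "24 * C * u * (t/2) powr - \<delta> \<le> (1/2) * u powr - \<delta>"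
      using u8 t2u by (simp add: powr_minus field_simps)
    have "3 * C * psi u * (real m * S) \<le> 3 * C * u * (4 * t * S)"
      using C_ge psiu S0 pieces(2) u8 by (intro mult_mono) auto
    also have "\<dots> = s * K * (1/2)^k * (24 * C * u * (t/2) powr - \<delta>)"
      using t2u u8 by (simp add: S_def s'_def)
    also have "\<dots> \<le> s * K * (1/2)^k * ((1/2) * u powr - \<delta>)"
      using gr s K0 by (intro mult_left_mono) auto
    finally show "3 * C * psi u * (real (card {..<m}) * S) \<le> s * K * (1/2)^Suc k * u powr - \<delta>"
      by (simp add: mult_ac)
  qed simp
qed

lemma gauge_null_Xset:
  fixes h p :: "real \<Rightarrow> real" and t0 \<delta> C5 :: real
  assumes C5: "C5 = 2 * (1 + 2 * C^2)"
    and t0: "0 < t0" and \<delta>: "0 < \<delta>"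
    and h_def: "\<forall>t\<in>{0<..<t0}. h t = t / p (1 / t)"
    and p_mono: "mono_on {1 / t0<..} p" and p_pos: "\<forall>s>1 / t0. p s > 0"
    and tp_mono: "mono_on {0<..<t0} (\<lambda>t. t * p (1 / t))"
    and h_mono: "mono_on {0<..<t0} h" and h_pos: "\<forall>t\<in>{0<..<t0}. h t > 0"
    and scale: "\<And>t. a \<le> t \<Longrightarrow> C5 * psi t / t \<le> 1/2 \<and> C5 * psi t / t < t0"
    and p_ge: "\<And>t. a \<le> t \<Longrightarrow> ln t powr (1 + \<delta>) \<le> p (t * ln t / psi t) \<and> 1 / t0 < t * ln t / psi t"
    and growth: "\<And>u. a \<le> u \<Longrightarrow> 48 * C * u powr (1 + \<delta>) \<le> (Er lam u / 2) powr \<delta>"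
  shows "gauge_hausdorff h t0 (Xset lam a psi) = 0"
proof -
  define K where "K = 12 * C * C5 * 2 powr (1 + \<delta>)"
  have C5ge: "6 \<le> C5" using C_ge one_le_power[of C 2] by (simp add: C5)
  have K0: "0 \<le> K" using C_ge C5ge by (simp add: K_def)
  have "gauge_hausdorff h t0 (slab u) = 0" if u: "a \<le> u" for u
  proof (rule gauge_null_if_finite_cover[OF h_mono _ h_pos])
    fix \<eta> \<epsilon> :: real assume \<eta>: "0 < \<eta>" and \<epsilon>: "0 < \<epsilon>"
    define s where "s = 1 / (C5 * u)"
    have u8: "8 \<le> u" using u a_ge by simp
    have C5u: "1 \<le> C5 * u" using mult_mono[of 1 C5 1 u] C5ge u8 by simp
    have s: "0 < s" "s \<le> 1" using C5u by (auto simp: s_def)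
    \<comment> \<open>The price of returning from \<open>h (s * r)\<close> to \<open>h r\<close>. It
      does not depend on \<open>k\<close>, so a large \<open>k\<close> makes the sum small.\<close>
    define B where "B = (1 / s^2) * (s * K * u powr - \<delta>)"
    have "0 \<le> B" using s K0 by (simp add: B_def)
    have "\<exists>k. (1/2::real)^k < min (min \<eta> (t0/2)) (\<epsilon> / (B + 1))"
      using \<eta> \<epsilon> t0 \<open>0 \<le> B\<close> by (intro real_arch_pow_inv) auto
    then obtain k where k: "(1/2::real)^k < \<eta>" "(1/2::real)^k < t0/2" "(1/2::real)^k < \<epsilon> / (B + 1)" by auto
    have "(1/2::real)^Suc k \<le> (1/2)^k" by simp
    then have k': "(1/2::real)^Suc k \<le> \<eta>" "(1/2::real)^Suc k < t0" using k t0 by linarith+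
    have "finite_cover (\<lambda>r. h (s * r)) ((1/2)^Suc k) (slab u) (s * K * (1/2)^k * u powr - \<delta>)"
      using s by (intro slab_cover[OF C5 K_def t0 \<delta> h_def p_mono scale p_ge growth u]) (auto simp: s_def)
    then obtain xs where xs: "slab u \<subseteq> (\<Union>q\<in>set xs. fst q)"
       "\<forall>q\<in>set xs. 0 < snd q \<and> snd q \<le> (1/2)^Suc k \<and> (\<forall>x\<in>fst q. \<forall>y\<in>fst q. dist x y \<le> snd q)"
       "(\<Sum>q\<leftarrow>xs. h (s * snd q)) \<le> s * K * (1/2)^k * u powr - \<delta>"
      unfolding finite_cover_def by blast
    have "(\<Sum>q\<leftarrow>xs. h (snd q)) \<le> (\<Sum>q\<leftarrow>xs. (1 / s^2) * h (s * snd q))"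
    proof (rule sum_list_mono)
      fix q assume "q \<in> set xs"
      then have "0 < snd q" "snd q < t0" using xs(2) k'(2) by fastforce+
      then show "h (snd q) \<le> (1 / s^2) * h (s * snd q)"
        using s by (intro gauge_scaling[OF h_def p_pos tp_mono])
    qed
    also have "\<dots> = (1 / s^2) * (\<Sum>q\<leftarrow>xs. h (s * snd q))" by (rule sum_list_const_mult)
    also have "\<dots> \<le> (1 / s^2) * (s * K * (1/2)^k * u powr - \<delta>)" using xs(3) by (intro mult_left_mono) auto
    also have "\<dots> = B * (1/2)^k" by (simp add: B_def)
    also have "\<dots> \<le> (B + 1) * (1/2)^k" by (intro mult_right_mono) auto
    also have "\<dots> \<le> \<epsilon>" using k(3) \<open>0 \<le> B\<close> by (simp add: field_simps)
    finally have "(\<Sum>q\<leftarrow>xs. h (snd q)) \<le> \<epsilon>" .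
    moreover have "\<forall>q\<in>set xs. 0 < snd q \<and> snd q \<le> \<eta> \<and> (\<forall>x\<in>fst q. \<forall>y\<in>fst q. dist x y \<le> snd q)"
      using xs(2) k'(1) by fastforce
    ultimately show "finite_cover h \<eta> (slab u) \<epsilon>" unfolding finite_cover_def using xs(1) by blast
  qed
  then have "gauge_hausdorff h t0 (\<Union>i::nat. slab (a + real i)) = 0"
    by (intro gauge_null_UN) auto
  moreover have "Xset lam a psi \<subseteq> (\<Union>i::nat. slab (a + real i))"
  proof
    fix z assume z: "z \<in> Xset lam a psi"
    then have "a < Re z" by (rule Xset_D)
    define i where "i = nat \<lfloor>Re z - a\<rfloor>"
    have "real i = of_int \<lfloor>Re z - a\<rfloor>" using \<open>a < Re z\<close> by (simp add: i_def)
    then have "a + real i \<le> Re z" "Re z \<le> a + real i + 1" by linarith+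
    then show "z \<in> (\<Union>i::nat. slab (a + real i))" using z by blast
  qed
  ultimately show ?thesis by (rule gauge_null_subset)
qed

end

section \<open>Hairs through finitely many prescribed branches\<close>

lemma log_branch_measurable:
  assumes "0 < lam"
  shows "log_branch lam n \<in> borel_measurable borel"
proof -
  have "(\<lambda>w. if w \<in> {w. 0 < Re w} then Ln (w / of_real lam) + of_real (2 * of_int n * pi) * \<i> else 0)
      \<in> borel_measurable borel"
  proof (rule borel_measurable_continuous_on_if)
    show "{w. 0 < Re w} \<in> sets borel" by (intro borel_open open_halfspace_Re_gt)
    show "continuous_on {w. 0 < Re w} (\<lambda>w. Ln (w / of_real lam) + of_real (2 * of_int n * pi) * \<i>)"
      using assms by (intro continuous_intros) (auto simp: complex_nonpos_Reals_iff divide_le_0_iff)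
  qed simp
  then show ?thesis by (simp add: log_branch_def[abs_def])
qed

context exp_strip
begin

text \<open>The denominator keeps the shifts \<open>2 * pi * n\<close> below
  \<open>psi x / (2 * C)\<close>: the factor \<open>C\<close> pays for replacing
  \<open>psi x\<close> by \<open>psi\<close> at a nearby real part, and half of the strip remains
  for errors.\<close>

definition branch_max :: "real \<Rightarrow> int" where
  "branch_max x = \<lfloor>psi x / (4 * pi * C)\<rfloor>"

text \<open>For a fixed choice of branches the point runs along a curve as \<open>x\<close> varies;
  for \<open>a \<le> x\<close> its \<open>N\<close>-th iterate is the real number
  \<open>(Er lam ^^ N) x\<close>.\<close>

fun hair :: "nat \<Rightarrow> real \<Rightarrow> complex set" where
  "hair 0 x = {of_real x}"
| "hair (Suc N) x = (\<Union>n\<in>{- branch_max x..branch_max x}. log_branch lam n ` hair N (Er lam x))"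

text \<open>The expectation of \<open>f\<close> at a random point of \<open>hair N x\<close>, when each of the \<open>N\<close> branches is chosen
  independently and uniformly from its admissible range. This range depends on \<open>x\<close>, which
  makes every total mass equal to the length of the parameter interval.\<close>

fun avg :: "nat \<Rightarrow> (complex \<Rightarrow> real) \<Rightarrow> real \<Rightarrow> real" where
  "avg 0 f x = f (of_real x)"
| "avg (Suc N) f x =
    (\<Sum>n\<in>{- branch_max x..branch_max x}. avg N (\<lambda>w. f (log_branch lam n w)) (Er lam x)) / (2 * of_int (branch_max x) + 1)"

lemma piC: "1 \<le> 4 * pi * C"
  using mult_mono[of 1 "4 * pi" 1 C] pi_gt3 C_ge by simp

lemma branch_max_bounds:
  assumes "a \<le> x"
  shows "0 \<le> branch_max x" "2 * pi * of_int (branch_max x) \<le> psi x / (2 * C)" "psi x / (4 * pi * C) \<le> 2 * of_int (branch_max x) + 1"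
proof -
  have p: "0 \<le> psi x / (4 * pi * C)" using psi_ge'[OF assms] piC by (intro divide_nonneg_nonneg) linarith+
  then show M0: "0 \<le> branch_max x" by (simp add: branch_max_def)
  have "of_int (branch_max x) \<le> psi x / (4 * pi * C)" by (simp add: branch_max_def)
  then have "2 * pi * of_int (branch_max x) \<le> 2 * pi * (psi x / (4 * pi * C))" by (intro mult_left_mono) auto
  then show "2 * pi * of_int (branch_max x) \<le> psi x / (2 * C)" by (simp add: field_simps)
  have "psi x / (4 * pi * C) \<le> of_int (branch_max x) + 1" unfolding branch_max_def by linarith
  then show "psi x / (4 * pi * C) \<le> 2 * of_int (branch_max x) + 1" using M0 by linarith
qed

lemma log_branch_Er: "log_branch lam n (of_real (Er lam x)) = Complex x (2 * of_int n * pi)"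
proof -
  have "Ln (of_real (Er lam x) / of_real lam) = of_real x"
    using lam_pos by (simp add: Er_def exp_of_real[symmetric] Ln_of_real flip: of_real_divide)
  then show ?thesis using lam_pos by (simp add: log_branch_def Er_pos complex_eq_iff)
qed

lemma dist_half_Re:
  assumes "dist w (of_real y) \<le> y / 2"
  shows "y / 2 \<le> Re w"
proof -
  have "\<bar>Re (w - of_real y)\<bar> \<le> y / 2" using assms abs_Re_le_cmod[of "w - of_real y"] by (simp add: dist_norm)
  then show ?thesis unfolding minus_complex.sel Re_complex_of_real abs_le_iff by linarith
qed

text \<open>The Lipschitz constant \<open>2 / Er lam x\<close> times the radius
  \<open>Er lam x / 2\<close> is 1: a logarithm turns a relative error into a bounded one, so errors
  do not accumulate.\<close>

lemma log_branch_near: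
  assumes "dist w (of_real (Er lam x)) \<le> Er lam x / 2"
  shows "dist (log_branch lam n w) (Complex x (2 * of_int n * pi)) \<le> 1"
proof -
  have e: "0 < Er lam x" using lam_pos by (rule Er_pos)
  have "dist (log_branch lam n w) (log_branch lam n (of_real (Er lam x)))
      \<le> (1 / (Er lam x / 2)) * dist w (of_real (Er lam x))"
    using lam_pos e dist_half_Re[OF assms] by (intro log_branch_lipschitz) auto
  also have "\<dots> \<le> (1 / (Er lam x / 2)) * (Er lam x / 2)" using assms e by (intro mult_left_mono) auto
  finally show ?thesis using e by (simp add: log_branch_Er)
qed

text \<open>The relative error 1/2 reproduces itself: after one logarithm the error is 1, and the
  branch shift adds at most \<open>psi x / 2\<close>, small against \<open>x\<close>.\<close>

lemma hair_near:
  assumes "a \<le> x" "z \<in> hair N x"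
  shows "dist z (of_real x) \<le> x / 2"
  using assms
proof (induction N arbitrary: x z)
  case 0
  then show ?case using a_ge by simp
next
  case (Suc N)
  obtain n w where n: "n \<in> {- branch_max x..branch_max x}" and w: "w \<in> hair N (Er lam x)" and z: "z = log_branch lam n w"
    using Suc.prems(2) by auto
  have "dist w (of_real (Er lam x)) \<le> Er lam x / 2"
    using Suc.IH[OF Er_ge_a[OF Suc.prems(1)] w] .
  then have 1: "dist z (Complex x (2 * of_int n * pi)) \<le> 1" unfolding z by (rule log_branch_near)
  have "dist (Complex x (2 * of_int n * pi)) (of_real x) = \<bar>2 * of_int n * pi\<bar>"
    by (simp add: dist_norm cmod_def)
  also have "\<dots> = 2 * pi * \<bar>of_int n\<bar>" by (simp add: abs_mult)
  also have "\<dots> \<le> 2 * pi * of_int (branch_max x)" using n by (intro mult_left_mono) auto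
  also have "\<dots> \<le> psi x / (2 * C)" by (rule branch_max_bounds[OF Suc.prems(1)])
  also have "\<dots> \<le> psi x / 2" using psi_ge'[OF Suc.prems(1)] C_ge by (intro divide_left_mono) auto
  finally have "dist (Complex x (2 * of_int n * pi)) (of_real x) \<le> psi x / 2" .
  then have "dist z (of_real x) \<le> 1 + psi x / 2"
    using 1 dist_triangle[of z "of_real x" "Complex x (2 * of_int n * pi)"] by linarith
  also have "\<dots> \<le> x / 2" using psi_small[OF Suc.prems(1)] a_ge Suc.prems(1) by simp
  finally show ?case .
qed

lemma hair_Suc_near:
  assumes "a \<le> x" "w \<in> hair N (Er lam x)"
  shows "0 < Re w" "\<bar>Re (log_branch lam n w) - x\<bar> \<le> 1" "\<bar>Im (log_branch lam n w) - 2 * of_int n * pi\<bar> \<le> 1"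
proof -
  have *: "dist w (of_real (Er lam x)) \<le> Er lam x / 2" using assms Er_ge_a hair_near by blast
  then show "0 < Re w" using dist_half_Re Er_pos[OF lam_pos, of x] by force
  have "norm (log_branch lam n w - Complex x (2 * of_int n * pi)) \<le> 1"
    using log_branch_near[OF *] by (simp add: dist_norm)
  then show "\<bar>Re (log_branch lam n w) - x\<bar> \<le> 1" "\<bar>Im (log_branch lam n w) - 2 * of_int n * pi\<bar> \<le> 1"
    using abs_Re_le_cmod[of "log_branch lam n w - Complex x (2 * of_int n * pi)"]
      abs_Im_le_cmod[of "log_branch lam n w - Complex x (2 * of_int n * pi)"] by auto
qed

lemma hair_bounds:
  assumes "a \<le> x" "z \<in> hair N x"
  shows "\<bar>Re z - x\<bar> \<le> 1" "\<bar>Im z\<bar> \<le> 1 + psi x / (2 * C)"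
proof -
  have "\<bar>Re z - x\<bar> \<le> 1 \<and> \<bar>Im z\<bar> \<le> 1 + psi x / (2 * C)"
  proof (cases N)
    case 0
    then show ?thesis using assms psi_ge'[OF assms(1)] C_ge by simp
  next
    case (Suc N')
    then obtain n w where n: "n \<in> {- branch_max x..branch_max x}" and w: "w \<in> hair N' (Er lam x)" and z: "z = log_branch lam n w"
      using assms(2) by auto
    have "\<bar>2 * real_of_int n * pi\<bar> = 2 * pi * \<bar>real_of_int n\<bar>" by (simp add: abs_mult)
    also have "\<dots> \<le> 2 * pi * of_int (branch_max x)" using n by (intro mult_left_mono) auto
    also have "\<dots> \<le> psi x / (2 * C)" by (rule branch_max_bounds[OF assms(1)])
    finally show ?thesis using hair_Suc_near(2,3)[OF assms(1) w, of n] by (auto simp: z)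
  qed
  then show "\<bar>Re z - x\<bar> \<le> 1" "\<bar>Im z\<bar> \<le> 1 + psi x / (2 * C)" by auto
qed

lemma E_map_hair:
  assumes "a \<le> x" "z \<in> hair (Suc N) x"
  shows "E_map lam z \<in> hair N (Er lam x)"
proof -
  obtain n w where w: "w \<in> hair N (Er lam x)" and z: "z = log_branch lam n w"
    using assms(2) by auto
  then show ?thesis using hair_Suc_near(1)[OF assms(1) w] lam_pos by (simp add: E_map_log_branch)
qed

lemma E_map_funpow_hair:
  assumes "a \<le> x" "z \<in> hair (j + N) x"
  shows "(E_map lam ^^ j) z \<in> hair N ((Er lam ^^ j) x)"
  using assms
proof (induction j arbitrary: x z)
  case (Suc j)
  have "E_map lam z \<in> hair (j + N) (Er lam x)" using Suc.prems by (intro E_map_hair) auto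
  then have "(E_map lam ^^ j) (E_map lam z) \<in> hair N ((Er lam ^^ j) (Er lam x))"
    using Suc.IH Er_ge_a Suc.prems(1) by blast
  then show ?case by (simp add: funpow_swap1)
qed simp

lemma avg_mono:
  assumes "a \<le> x" "\<And>z. z \<in> hair N x \<Longrightarrow> f z \<le> g z"
  shows "avg N f x \<le> avg N g x"
  using assms
proof (induction N arbitrary: f g x)
  case (Suc N)
  have "avg N (\<lambda>w. f (log_branch lam n w)) (Er lam x) \<le> avg N (\<lambda>w. g (log_branch lam n w)) (Er lam x)"
    if "n \<in> {- branch_max x..branch_max x}" for n
    using that by (intro Suc.IH Er_ge_a Suc.prems) auto
  then have "(\<Sum>n\<in>{- branch_max x..branch_max x}. avg N (\<lambda>w. f (log_branch lam n w)) (Er lam x))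
      \<le> (\<Sum>n\<in>{- branch_max x..branch_max x}. avg N (\<lambda>w. g (log_branch lam n w)) (Er lam x))"
    by (rule sum_mono)
  then show ?case using branch_max_bounds(1)[OF Suc.prems(1)] by (auto intro!: divide_right_mono)
qed simp

lemma avg_const: "a \<le> x \<Longrightarrow> avg N (\<lambda>z. c) x = c"
proof (induction N arbitrary: x)
  case (Suc N)
  have "0 \<le> branch_max x" by (rule branch_max_bounds[OF Suc.prems])
  then show ?case using Suc.IH[OF Er_ge_a[OF Suc.prems]] by simp
qed simp

lemma avg_sum: "avg N (\<lambda>z. \<Sum>i\<in>I. f i z) x = (\<Sum>i\<in>I. avg N (f i) x)"
proof (induction N arbitrary: f x)
  case (Suc N)
  then show ?case
    by (simp add: sum_divide_distrib[symmetric] sum.swap[of _ "{- branch_max x..branch_max x}" I])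
qed simp

lemma branch_max_measurable [measurable]: "branch_max \<in> borel \<rightarrow>\<^sub>M count_space UNIV"
proof -
  have [measurable]: "psi \<in> borel_measurable borel" using psi_mono by (rule borel_measurable_mono)
  show ?thesis unfolding branch_max_def[abs_def] by measurable
qed

lemma avg_measurable [measurable]:
  assumes [measurable]: "f \<in> borel_measurable borel"
  shows "avg N f \<in> borel_measurable borel"
  using assms
proof (induction N arbitrary: f)
  case 0
  then have [measurable]: "f \<in> borel_measurable borel" .
  have [measurable]: "(complex_of_real :: real \<Rightarrow> complex) \<in> borel_measurable borel"
    by (intro borel_measurable_continuous_onI continuous_intros)
  have "avg 0 f = (\<lambda>x. f (of_real x))" by (simp add: fun_eq_iff)
  then show ?case by simp
next
  case (Suc N)
  note [measurable] = Suc.prems log_branch_measurable[OF lam_pos]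
  have [measurable]: "Er lam \<in> borel_measurable borel"
    unfolding Er_def[abs_def] by measurable
  have [measurable]: "avg N (\<lambda>w. f (log_branch lam n w)) \<in> borel_measurable borel" for n
    by (intro Suc.IH) measurable
  \<comment> \<open>The index range varies with \<open>x\<close>; separating it as an integer
    parameter \<open>m\<close> reduces measurability to countably many fixed ranges.\<close>
  define F where "F m x = (\<Sum>n\<in>{- m..m}. avg N (\<lambda>w. f (log_branch lam n w)) (Er lam x)) / (2 * of_int m + 1)" for m x
  have "F m \<in> borel_measurable borel" for m unfolding F_def by measurable
  then have "(\<lambda>x. F (branch_max x) x) \<in> borel_measurable borel"
    by (rule measurable_compose_countable) measurable
  moreover have "avg (Suc N) f = (\<lambda>x. F (branch_max x) x)" by (simp add: fun_eq_iff F_def)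
  ultimately show ?case by simp
qed

text \<open>The parameter runs over a half-line, which \<open>Er lam\<close> maps into itself; a
  change of variables then leads to a bound by the same functional.\<close>

definition mass :: "nat \<Rightarrow> complex set \<Rightarrow> ennreal" where
  "mass N A = (\<integral>\<^sup>+x. ennreal (avg N (indicator A) x) * indicator {a..} x \<partial>lborel)"

lemma avg_indicator_ge_0: "a \<le> x \<Longrightarrow> 0 \<le> avg N (indicator A) x"
  using avg_mono[of x N "\<lambda>_. 0" "indicator A"] avg_const[of x N 0] by simp

lemma avg_indicator_le_1: "a \<le> x \<Longrightarrow> avg N (indicator A) x \<le> 1"
  using avg_mono[of x N "indicator A" "\<lambda>_. 1"] avg_const[of x N 1] by (simp add: indicator_def)

lemma avg_indicator_eq_0:
  assumes "a \<le> x" "hair N x \<inter> A = {}"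
  shows "avg N (indicator A) x = 0"
proof -
  have "avg N (indicator A) x \<le> avg N (\<lambda>_. 0) x"
    using assms by (intro avg_mono) (auto simp: indicator_def)
  then show ?thesis using avg_const[OF assms(1), of N 0] avg_indicator_ge_0[OF assms(1), of N A] by simp
qed

end

section \<open>The mass of small sets\<close>

context exp_strip
begin

declare avg.simps(2) [simp del]

text \<open>Substituting \<open>y = Er lam x\<close> brings in the density \<open>1 / y\<close>, at
  most \<open>1 / Er lam l\<close>; the range is then enlarged to the half-line.\<close>

lemma nn_integral_Er_le:
  fixes G :: "real \<Rightarrow> ennreal"
  assumes [measurable]: "G \<in> borel_measurable borel" and l: "a \<le> l" "l < r"
  shows "(\<integral>\<^sup>+x. G (Er lam x) * indicator {l..r} x \<partial>lborel)
    \<le> ennreal (1 / Er lam l) * (\<integral>\<^sup>+y. G y * indicator {a..} y \<partial>lborel)"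
proof -
  have el: "a \<le> Er lam l" "0 < Er lam l" using l Er_ge_a lam_pos Er_pos by auto
  have "(\<integral>\<^sup>+x. G (Er lam x) * indicator {l..r} x \<partial>lborel)
      = (\<integral>\<^sup>+x. (G (Er lam x) * ennreal (1 / Er lam x)) * ennreal (Er lam x) * indicator {l..r} x \<partial>lborel)"
  proof (intro nn_integral_cong)
    fix x
    have "ennreal (1 / Er lam x) * ennreal (Er lam x) = 1"
      using Er_pos[OF lam_pos, of x] by (simp flip: ennreal_mult')
    then show "G (Er lam x) * indicator {l..r} x
      = (G (Er lam x) * ennreal (1 / Er lam x)) * ennreal (Er lam x) * indicator {l..r} x"
      by (simp add: mult.assoc)
  qed
  also have "\<dots> = (\<integral>\<^sup>+y. (G y * ennreal (1 / y)) * indicator {Er lam l..Er lam r} y \<partial>lborel)"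
  proof (rule nn_integral_substitution_aux[symmetric])
    show "(Er lam has_real_derivative Er lam x) (at x)" for x
      unfolding Er_def[abs_def] by (auto intro!: derivative_eq_intros)
    show "continuous_on {l..r} (Er lam)" unfolding Er_def[abs_def] by (intro continuous_intros)
    show "0 \<le> Er lam x" for x using Er_pos[OF lam_pos, of x] by simp
  qed (use l in auto)
  also have "\<dots> \<le> (\<integral>\<^sup>+y. ennreal (1 / Er lam l) * (G y * indicator {a..} y) \<partial>lborel)"
  proof (intro nn_integral_mono)
    fix y
    show "(G y * ennreal (1 / y)) * indicator {Er lam l..Er lam r} y
        \<le> ennreal (1 / Er lam l) * (G y * indicator {a..} y)"
    proof (cases "y \<in> {Er lam l..Er lam r}")
      case True
      then have "ennreal (1 / y) \<le> ennreal (1 / Er lam l)" "a \<le> y"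
        using el by (auto intro!: ennreal_leI frac_le)
      then show ?thesis using True by (simp add: mult.commute[of "G y"] mult_right_mono)
    qed simp
  qed
  also have "\<dots> = ennreal (1 / Er lam l) * (\<integral>\<^sup>+y. G y * indicator {a..} y \<partial>lborel)"
    by (rule nn_integral_cmult) measurable
  finally show ?thesis .
qed

lemma branch_max_lower:
  assumes "a \<le> x" "a \<le> y" "y / 2 \<le> x"
  shows "psi y / (4 * pi * C^2) \<le> 2 * of_int (branch_max x) + 1"
proof -
  have "psi y \<le> C * psi (y / 2)" using doubling[of "y/2"] assms by simp
  also have "\<dots> \<le> C * psi x" using assms C_ge by (intro mult_left_mono psi_le) auto
  finally have "psi y / (4 * pi * C^2) \<le> C * psi x / (4 * pi * C^2)" by (intro divide_right_mono) auto
  also have "\<dots> = psi x / (4 * pi * C)" using C_ge by (simp add: power2_eq_square)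
  also have "\<dots> \<le> 2 * of_int (branch_max x) + 1" by (rule branch_max_bounds[OF assms(1)])
  finally show ?thesis .
qed

text \<open>\<open>4 * pi * C^2\<close> comes from comparing branch counts at nearby parameters,
  \<open>exp 3\<close> from parameters up to 3 below \<open>x1\<close>. In
  \<open>large_const\<close> the counts give \<open>8 * pi * C^2\<close>, and the parameter interval
  has length \<open>6 * d\<close>.\<close>

definition step_const :: real where "step_const = 4 * pi * C^2 * exp 3"
definition large_const :: real where "large_const = 48 * pi * C^2"

text \<open>Points on branch \<open>n\<close> have imaginary part within 1 of
  \<open>2 * pi * n\<close>, so a set of diameter at most 1 meets a single branch, and
  \<open>A'\<close> is its preimage under that branch. The mass drops by the number of branches and
  by the derivative of \<open>Er lam\<close>.\<close>

lemma mass_step: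
  assumes A: "A \<in> sets borel" and d: "d \<le> 1" and diam: "\<And>z z'. z \<in> A \<Longrightarrow> z' \<in> A \<Longrightarrow> dist z z' \<le> d"
    and x1: "a \<le> x1" and ne: "hair (Suc N) x1 \<inter> A \<noteq> {}"
  obtains A' where "A' \<in> sets borel"
    "\<And>w w'. w \<in> A' \<Longrightarrow> w' \<in> A' \<Longrightarrow> dist w w' \<le> exp 2 * Er lam x1 * d"
    "hair N (Er lam x1) \<inter> A' \<noteq> {}"
    "mass (Suc N) A \<le> ennreal (step_const / (Er lam x1 * psi x1)) * mass N A'"
proof -
  obtain z1 n w1 where z1: "z1 \<in> A" and w1: "w1 \<in> hair N (Er lam x1)" and z1w1: "z1 = log_branch lam n w1"
    using ne by auto
  note near1 = hair_Suc_near(1)[OF x1 w1] hair_Suc_near(2,3)[OF x1 w1, of n, folded z1w1]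
  define A' where "A' = {w. 0 < Re w \<and> log_branch lam n w \<in> A}"
  note [measurable] = log_branch_measurable[OF lam_pos] A
  have A'[measurable]: "A' \<in> sets borel" unfolding A'_def by measurable
  have diam': "dist w w' \<le> exp 2 * Er lam x1 * d" if "w \<in> A'" "w' \<in> A'" for w w'
  proof -
    have re: "Re z \<le> x1 + 2" if "z \<in> A" for z
      using near1(2) diam[OF that z1] d abs_Re_le_cmod[of "z - z1"] by (auto simp: dist_norm)
    let ?z = "log_branch lam n w" and ?z' = "log_branch lam n w'"
    have zz: "?z \<in> A" "?z' \<in> A" using that by (auto simp: A'_def)
    have "dist w w' = dist (E_map lam ?z) (E_map lam ?z')"
      using that lam_pos by (simp add: A'_def E_map_log_branch)
    also have "\<dots> \<le> Er lam (x1 + 2) * dist ?z ?z'" using re zz lam_pos by (intro E_map_lipschitz) auto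
    also have "\<dots> \<le> Er lam (x1 + 2) * d" using diam[OF zz] Er_pos[OF lam_pos] by (intro mult_left_mono) (auto intro: less_imp_le)
    finally show ?thesis by (simp add: Er_add mult_ac)
  qed
  have ne': "hair N (Er lam x1) \<inter> A' \<noteq> {}" using w1 z1 z1w1 near1(1) by (auto simp: A'_def)
  \<comment> \<open>Three errors of size 1, from \<open>x\<close> to \<open>z\<close>, from
    \<open>z\<close> to \<open>z1\<close> and from \<open>z1\<close> to \<open>x1\<close>, confine
    the relevant parameters.\<close>
  define l where "l = max a (x1 - 3)"
  define r where "r = x1 + 3"
  have x18: "8 \<le> x1" using x1 a_ge by simp
  have psi1: "0 < psi x1" using psi_ge'[OF x1] by simp
  define c where "c = 4 * pi * C^2 / psi x1"
  have c0: "0 < c" using psi1 C_ge by (simp add: c_def)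
  have pt: "avg (Suc N) (indicator A) x \<le> c * avg N (indicator A') (Er lam x) * indicator {l..r} x"
    if x: "a \<le> x" for x
  proof (cases "\<bar>x - x1\<bar> \<le> 3")
    case False
    have "hair (Suc N) x \<inter> A = {}"
    proof (rule ccontr)
      assume "hair (Suc N) x \<inter> A \<noteq> {}"
      then obtain z where z: "z \<in> hair (Suc N) x" "z \<in> A" by blast
      have "\<bar>Re z - x\<bar> \<le> 1" by (rule hair_bounds[OF x z(1)])
      moreover have "\<bar>Re (z - z1)\<bar> \<le> 1" using diam[OF z(2) z1] d abs_Re_le_cmod[of "z - z1"] by (simp add: dist_norm)
      ultimately show False using near1(2) False by simp
    qed
    then have "avg (Suc N) (indicator A) x = 0" by (rule avg_indicator_eq_0[OF x])
    moreover have "0 \<le> avg N (indicator A') (Er lam x)" by (rule avg_indicator_ge_0[OF Er_ge_a[OF x]])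
    ultimately show ?thesis using c0 by simp
  next
    case True
    then have xlr: "x \<in> {l..r}" using x by (auto simp: l_def r_def)
    have 0: "0 \<le> avg N (indicator A') (Er lam x)" by (rule avg_indicator_ge_0[OF Er_ge_a[OF x]])
    have bound: "avg N (\<lambda>w. indicator A (log_branch lam n' w)) (Er lam x)
        \<le> (if n' = n then avg N (indicator A') (Er lam x) else 0)" for n'
    proof (cases "n' = n")
      case True
      have "avg N (\<lambda>w. indicator A (log_branch lam n w)) (Er lam x) \<le> avg N (indicator A') (Er lam x)"
      proof (rule avg_mono[OF Er_ge_a[OF x]])
        fix w assume "w \<in> hair N (Er lam x)"
        then have "0 < Re w" by (rule hair_Suc_near(1)[OF x])
        then show "indicator A (log_branch lam n w) \<le> (indicator A' w :: real)"
          by (auto simp: A'_def indicator_def)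
      qed
      then show ?thesis using True by simp
    next
      case False
      have "avg N (\<lambda>w. indicator A (log_branch lam n' w)) (Er lam x) \<le> avg N (\<lambda>w. 0) (Er lam x)"
      proof (rule avg_mono[OF Er_ge_a[OF x]])
        fix w assume w: "w \<in> hair N (Er lam x)"
        let ?z = "log_branch lam n' w"
        have "?z \<notin> A"
        proof
          assume "?z \<in> A"
          then have "norm (?z - z1) \<le> 1" using diam[OF _ z1] d by (fastforce simp: dist_norm)
          then have "\<bar>Im ?z - Im z1\<bar> \<le> 1" using abs_Im_le_cmod[of "?z - z1"] by simp
          then have "\<bar>2 * of_int n' * pi - 2 * of_int n * pi\<bar> \<le> 3"
            using near1(3) hair_Suc_near(3)[OF x w, of n'] by linarith
          moreover have "2 * of_int n' * pi - 2 * of_int n * pi = 2 * pi * of_int (n' - n)"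
            by (simp add: algebra_simps)
          ultimately have "2 * pi * \<bar>of_int (n' - n)\<bar> \<le> 3" by (simp add: abs_mult)
          moreover have "2 * pi * 1 \<le> 2 * pi * \<bar>of_int (n' - n)\<bar>"
            using False by (intro mult_left_mono) auto
          ultimately show False using pi_gt3 by linarith
        qed
        then show "indicator A ?z \<le> (0::real)" by simp
      qed
      then show ?thesis using False avg_const[OF Er_ge_a[OF x], of N 0] by simp
    qed
    have "(\<Sum>n'\<in>{- branch_max x..branch_max x}. avg N (\<lambda>w. indicator A (log_branch lam n' w)) (Er lam x))
        \<le> (\<Sum>n'\<in>{- branch_max x..branch_max x}. if n' = n then avg N (indicator A') (Er lam x) else 0)"
      by (intro sum_mono bound)
    also have "\<dots> \<le> avg N (indicator A') (Er lam x)" using 0 by (simp add: sum.delta)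
    finally have "avg (Suc N) (indicator A) x \<le> avg N (indicator A') (Er lam x) / (2 * of_int (branch_max x) + 1)"
      using branch_max_bounds(1)[OF x] by (auto intro: divide_right_mono simp: avg.simps(2))
    also have "\<dots> \<le> avg N (indicator A') (Er lam x) / (psi x1 / (4 * pi * C^2))"
    proof (rule divide_left_mono)
      show le: "psi x1 / (4 * pi * C^2) \<le> 2 * of_int (branch_max x) + 1" using True x x1 x18 by (intro branch_max_lower) auto
      have "0 < psi x1 / (4 * pi * C^2)" using psi1 C_ge by simp
      then show "0 < (2 * of_int (branch_max x) + 1) * (psi x1 / (4 * pi * C^2))" using le by (intro mult_pos_pos) auto
    qed (rule 0)
    also have "\<dots> = c * avg N (indicator A') (Er lam x) * indicator {l..r} x"
      using xlr by (simp add: c_def)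
    finally show ?thesis .
  qed
  have lr: "a \<le> l" "l < r" using x1 by (auto simp: l_def r_def)
  have "mass (Suc N) A \<le> (\<integral>\<^sup>+x. ennreal c * (ennreal (avg N (indicator A') (Er lam x)) * indicator {l..r} x) \<partial>lborel)"
    unfolding mass_def
  proof (intro nn_integral_mono)
    fix x
    show "ennreal (avg (Suc N) (indicator A) x) * indicator {a..} x
        \<le> ennreal c * (ennreal (avg N (indicator A') (Er lam x)) * indicator {l..r} x)"
    proof (cases "a \<le> x")
      case True
      have "ennreal (avg (Suc N) (indicator A) x)
          \<le> ennreal (c * avg N (indicator A') (Er lam x) * indicator {l..r} x)"
        using pt[OF True] by (rule ennreal_leI)
      also have "\<dots> = ennreal c * (ennreal (avg N (indicator A') (Er lam x)) * indicator {l..r} x)"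
        using c0 avg_indicator_ge_0[OF Er_ge_a[OF True], of N A']
        by (simp add: ennreal_mult'' ennreal_mult' indicator_def)
      finally show ?thesis using True by simp
    qed simp
  qed
  also have "\<dots> = ennreal c * (\<integral>\<^sup>+x. ennreal (avg N (indicator A') (Er lam x)) * indicator {l..r} x \<partial>lborel)"
  proof (rule nn_integral_cmult)
    have [measurable]: "Er lam \<in> borel_measurable borel" unfolding Er_def[abs_def] by measurable
    show "(\<lambda>x. ennreal (avg N (indicator A') (Er lam x)) * indicator {l..r} x) \<in> borel_measurable lborel"
      by measurable
  qed
  also have "\<dots> \<le> ennreal c * (ennreal (1 / Er lam l) * mass N A')"
    unfolding mass_def using lr by (intro mult_left_mono nn_integral_Er_le) auto
  also have "\<dots> \<le> ennreal c * (ennreal (exp 3 / Er lam x1) * mass N A')"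
  proof (intro mult_left_mono mult_right_mono ennreal_leI)
    have "Er lam x1 \<le> Er lam (l + 3)" using lam_pos by (intro Er_mono) (auto simp: l_def)
    then have "Er lam x1 \<le> Er lam l * exp 3" by (simp add: Er_add)
    then show "1 / Er lam l \<le> exp 3 / Er lam x1"
      using Er_pos[OF lam_pos, of l] Er_pos[OF lam_pos, of x1] by (simp add: field_simps)
  qed auto
  also have "\<dots> = ennreal (step_const / (Er lam x1 * psi x1)) * mass N A'"
  proof -
    have "ennreal c * ennreal (exp 3 / Er lam x1) = ennreal (step_const / (Er lam x1 * psi x1))"
    proof -
      have "c * (exp 3 / Er lam x1) = step_const / (Er lam x1 * psi x1)"
        by (simp add: c_def step_const_def mult_ac)
      then show ?thesis using c0 ennreal_mult'[of c "exp 3 / Er lam x1"] by simp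
    qed
    then show ?thesis by (simp flip: mult.assoc)
  qed
  finally show ?thesis using that[OF A' diam' ne'] by blast
qed

text \<open>The branches met have indices within \<open>d / 2\<close> of a fixed one, because
  \<open>2 * pi * m \<le> d + 2 \<le> 3 * d\<close>; for \<open>1 \<le> d\<close> there are at most
  \<open>2 * d\<close> of them.\<close>

lemma avg_indicator_le_card:
  assumes x: "a \<le> x" and d: "1 \<le> d" and diam: "\<And>z z'. z \<in> A \<Longrightarrow> z' \<in> A \<Longrightarrow> dist z z' \<le> d"
  shows "avg (Suc N) (indicator A) x \<le> 2 * d / (2 * of_int (branch_max x) + 1)"
proof -
  define J where "J = {n\<in>{- branch_max x..branch_max x}. \<exists>w\<in>hair N (Er lam x). log_branch lam n w \<in> A}"
  have "(\<Sum>n\<in>{- branch_max x..branch_max x}. avg N (\<lambda>w. indicator A (log_branch lam n w)) (Er lam x))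
      \<le> (\<Sum>n\<in>{- branch_max x..branch_max x}. if n \<in> J then 1 else 0)"
  proof (rule sum_mono)
    fix n assume n: "n \<in> {- branch_max x..branch_max x}"
    have "avg N (\<lambda>w. indicator A (log_branch lam n w)) (Er lam x) \<le> avg N (\<lambda>w. if n \<in> J then 1 else 0) (Er lam x)"
      by (rule avg_mono[OF Er_ge_a[OF x]]) (use n in \<open>auto simp: J_def indicator_def\<close>)
    then show "avg N (\<lambda>w. indicator A (log_branch lam n w)) (Er lam x) \<le> (if n \<in> J then 1 else 0)"
      by (simp only: avg_const[OF Er_ge_a[OF x]])
  qed
  also have "\<dots> = real (card J)"
  proof -
    have "{- branch_max x..branch_max x} \<inter> J = J" by (auto simp: J_def)
    then show ?thesis by (simp add: sum.If_cases)
  qed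
  also have "\<dots> \<le> 2 * d"
  proof (cases "J = {}")
    case False
    then obtain n0 where n0: "n0 \<in> J" by blast
    then obtain w0 where w0: "w0 \<in> hair N (Er lam x)" "log_branch lam n0 w0 \<in> A" by (auto simp: J_def)
    have "J \<subseteq> {n0 - \<lfloor>d/2\<rfloor> .. n0 + \<lfloor>d/2\<rfloor>}"
    proof
      fix n assume "n \<in> J"
      then obtain w where w: "w \<in> hair N (Er lam x)" "log_branch lam n w \<in> A" by (auto simp: J_def)
      have "\<bar>Im (log_branch lam n w) - Im (log_branch lam n0 w0)\<bar> \<le> d"
        using diam[OF w(2) w0(2)] abs_Im_le_cmod[of "log_branch lam n w - log_branch lam n0 w0"]
        by (simp add: dist_norm)
      then have "\<bar>2 * of_int n * pi - 2 * of_int n0 * pi\<bar> \<le> d + 2"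
        using hair_Suc_near(3)[OF x w(1), of n] hair_Suc_near(3)[OF x w0(1), of n0] by linarith
      moreover have "2 * of_int n * pi - 2 * of_int n0 * pi = 2 * pi * of_int (n - n0)"
        by (simp add: algebra_simps)
      moreover define m where "m = \<bar>real_of_int (n - n0)\<bar>"
      ultimately have "2 * pi * m \<le> d + 2" by (simp add: abs_mult)
      moreover have "2 * 3 * m \<le> 2 * pi * m"
        using pi_gt3 by (intro mult_right_mono mult_left_mono) (auto simp: m_def)
      ultimately have "m \<le> d/2" using d by linarith
      then have "real_of_int (n - n0) \<le> d/2" "real_of_int (n0 - n) \<le> d/2"
        unfolding m_def of_int_diff by linarith+
      then have "n - n0 \<le> \<lfloor>d/2\<rfloor>" "n0 - n \<le> \<lfloor>d/2\<rfloor>" unfolding le_floor_iff by auto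
      then show "n \<in> {n0 - \<lfloor>d/2\<rfloor> .. n0 + \<lfloor>d/2\<rfloor>}" by auto
    qed
    then have "card J \<le> card {n0 - \<lfloor>d/2\<rfloor> .. n0 + \<lfloor>d/2\<rfloor>}" by (intro card_mono) auto
    also have "\<dots> = nat (2 * \<lfloor>d/2\<rfloor> + 1)" by simp
    finally have "int (card J) \<le> 2 * \<lfloor>d/2\<rfloor> + 1" using d by (simp add: le_nat_iff)
    then have "real (card J) \<le> 2 * of_int \<lfloor>d/2\<rfloor> + 1" by linarith
    also have "\<dots> \<le> 2 * d" using d by linarith
    finally show ?thesis .
  qed (use d in simp)
  finally show ?thesis using branch_max_bounds(1)[OF x] by (auto intro!: divide_right_mono simp: avg.simps(2))
qed

text \<open>The parameter is confined to an interval of length \<open>6 * d\<close>, and the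
  proportion of first branches that meet \<open>A\<close> is at most of order
  \<open>d / psi x1\<close>.\<close>

lemma mass_large:
  assumes d: "1 \<le> d" and diam: "\<And>z z'. z \<in> A \<Longrightarrow> z' \<in> A \<Longrightarrow> dist z z' \<le> d"
    and x1: "a \<le> x1" and ne: "hair (Suc N) x1 \<inter> A \<noteq> {}"
  shows "mass (Suc N) A \<le> ennreal (large_const * d * min 1 (d / psi x1))"
proof -
  obtain z1 where z1: "z1 \<in> A" "z1 \<in> hair (Suc N) x1" using ne by blast
  have near1: "\<bar>Re z1 - x1\<bar> \<le> 1" by (rule hair_bounds[OF x1 z1(2)])
  have psi1: "0 < psi x1" using psi_ge'[OF x1] by simp
  define B where "B = 8 * pi * C^2 * min 1 (d / psi x1)"
  have C2: "1 \<le> C^2" using C_ge by simp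
  have B0: "0 \<le> B" using d psi1 by (simp add: B_def)
  have pt: "avg (Suc N) (indicator A) x \<le> B * indicator {x1 - 3 * d..x1 + 3 * d} x" if x: "a \<le> x" for x
  proof (cases "\<bar>x - x1\<bar> \<le> 3 * d")
    case False
    have "hair (Suc N) x \<inter> A = {}"
    proof (rule ccontr)
      assume "hair (Suc N) x \<inter> A \<noteq> {}"
      then obtain z where z: "z \<in> hair (Suc N) x" "z \<in> A" by blast
      have "\<bar>Re z - x\<bar> \<le> 1" by (rule hair_bounds[OF x z(1)])
      moreover have "\<bar>Re z - Re z1\<bar> \<le> d" using diam[OF z(2) z1(1)] abs_Re_le_cmod[of "z - z1"] by (simp add: dist_norm)
      ultimately show False using near1 False d by linarith
    qed
    then have "avg (Suc N) (indicator A) x = 0" by (rule avg_indicator_eq_0[OF x])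
    then show ?thesis using B0 by simp
  next
    case True
    have "avg (Suc N) (indicator A) x \<le> B"
    proof (cases "d < psi x1")
      case False
      then have "B = 8 * pi * C^2" using psi1 by (simp add: B_def min_def)
      moreover have "1 * 1 \<le> (8 * pi) * C^2" using C2 pi_gt3 by (intro mult_mono) auto
      ultimately show ?thesis using avg_indicator_le_1[OF x, of "Suc N" A] by linarith
    next
      case lt: True
      \<comment> \<open>Here \<open>d < psi x1 \<le> x1 / 8\<close> keeps \<open>x\<close> above
        \<open>x1 / 2\<close>, where branch counts are comparable.\<close>
      have "x1 / 2 \<le> x" using True lt psi_small[OF x1] x1 a_ge by linarith
      then have le: "psi x1 / (4 * pi * C^2) \<le> 2 * of_int (branch_max x) + 1" using x x1 by (intro branch_max_lower) auto
      have pos: "0 < psi x1 / (4 * pi * C^2)" using psi1 C_ge by simp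
      have "avg (Suc N) (indicator A) x \<le> 2 * d / (2 * of_int (branch_max x) + 1)"
        by (rule avg_indicator_le_card[OF x d diam])
      also have "\<dots> \<le> 2 * d / (psi x1 / (4 * pi * C^2))"
        using le pos d by (intro divide_left_mono mult_pos_pos) auto
      also have "\<dots> = B" using lt psi1 by (simp add: B_def min_def)
      finally show ?thesis .
    qed
    moreover have "x \<in> {x1 - 3 * d..x1 + 3 * d}" using True by auto
    ultimately show ?thesis by simp
  qed
  have "mass (Suc N) A \<le> (\<integral>\<^sup>+x. ennreal B * indicator {x1 - 3 * d..x1 + 3 * d} x \<partial>lborel)"
    unfolding mass_def
  proof (intro nn_integral_mono)
    fix x
    show "ennreal (avg (Suc N) (indicator A) x) * indicator {a..} x
        \<le> ennreal B * indicator {x1 - 3 * d..x1 + 3 * d} x"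
    proof (cases "a \<le> x")
      case True
      have "ennreal (avg (Suc N) (indicator A) x) \<le> ennreal (B * indicator {x1 - 3 * d..x1 + 3 * d} x)"
        using pt[OF True] by (rule ennreal_leI)
      then show ?thesis using True by (auto simp: indicator_def)
    qed simp
  qed
  also have "\<dots> = ennreal B * ennreal (6 * d)"
    using d by (simp add: nn_integral_cmult_indicator)
  also have "\<dots> = ennreal (large_const * d * min 1 (d / psi x1))"
  proof -
    have "B * (6 * d) = large_const * d * min 1 (d / psi x1)" by (simp add: B_def large_const_def)
    then show ?thesis using B0 d by (metis ennreal_mult' mult_nonneg_nonneg)
  qed
  finally show ?thesis .
qed

text \<open>The accumulated bound for the growth of diameters in \<open>k\<close> steps;
  \<open>exp 2\<close> is the distortion in \<open>mass_step\<close>.\<close>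

definition expansion :: "nat \<Rightarrow> real \<Rightarrow> real" where
  "expansion k x = (\<Prod>i<k. exp 2 * (Er lam ^^ Suc i) x)"

lemma expansion_0 [simp]: "expansion 0 x = 1"
  by (simp add: expansion_def)

lemma expansion_Suc: "expansion (Suc k) x = expansion k x * (exp 2 * (Er lam ^^ Suc k) x)"
  by (simp add: expansion_def)

lemma expansion_Suc_shift: "expansion (Suc k) x = exp 2 * Er lam x * expansion k (Er lam x)"
  unfolding expansion_def prod.lessThan_Suc_shift by (simp add: funpow_swap1)

lemma funpow_Er_pos: "a \<le> x \<Longrightarrow> 0 < (Er lam ^^ i) x"
  using Er_funpow_ge[of x i] a_ge by linarith

lemma expansion_factor_ge: "a \<le> x \<Longrightarrow> 2 \<le> exp 2 * (Er lam ^^ Suc i) x"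
proof -
  assume "a \<le> x"
  then have "8 \<le> (Er lam ^^ Suc i) x" using Er_funpow_ge[of x "Suc i"] a_ge by linarith
  moreover have "(1::real) \<le> exp 2" by simp
  ultimately have "1 * 8 \<le> exp 2 * (Er lam ^^ Suc i) x" by (intro mult_mono) auto
  then show ?thesis by simp
qed

lemma expansion_ge: "a \<le> x \<Longrightarrow> 2 ^ k \<le> expansion k x"
proof (induction k)
  case (Suc k)
  then show ?case
    unfolding expansion_Suc using mult_mono[OF Suc.IH[OF Suc.prems] expansion_factor_ge[OF Suc.prems, of k]]
    by (simp add: mult_ac order.trans[OF _ Suc.IH])
qed simp

lemma expansion_pos: "a \<le> x \<Longrightarrow> 0 < expansion k x"
  using expansion_ge[of x k] by (meson less_le_trans zero_less_numeral zero_less_power)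

lemma expansion_mono:
  assumes "a \<le> x" "x \<le> y" "j \<le> k"
  shows "expansion j x \<le> expansion k y"
proof -
  have "expansion j x \<le> expansion j y"
    unfolding expansion_def
  proof (rule prod_mono)
    fix i
    show "0 \<le> exp 2 * (Er lam ^^ Suc i) x \<and> exp 2 * (Er lam ^^ Suc i) x \<le> exp 2 * (Er lam ^^ Suc i) y"
      using funpow_Er_pos[OF assms(1), of "Suc i"] Er_funpow_mono[OF lam_pos assms(2), of "Suc i"]
      by (intro conjI mult_left_mono mult_nonneg_nonneg) auto
  qed
  also have "\<dots> \<le> expansion k y"
    using assms(3)
  proof (induction k rule: dec_induct)
    case (step k)
    have "expansion k y * 1 \<le> expansion k y * (exp 2 * (Er lam ^^ Suc k) y)"
      using expansion_pos[of y k] expansion_factor_ge[of y k] assms by (intro mult_left_mono) auto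
    then show ?case using step.IH by (simp add: expansion_Suc)
  qed simp
  finally show ?thesis .
qed

lemma step_const_pos: "0 < step_const"
  using C_ge by (simp add: step_const_def)

lemma large_const_pos: "0 < large_const"
  using C_ge by (simp add: large_const_def)

text \<open>\<open>mass_step\<close> is iterated while the diameter stays at most 1, and
  \<open>mass_large\<close> ends the recursion; \<open>k < N\<close> leaves it one branch to
  choose.\<close>

lemma mass_bound:
  assumes "a \<le> x" "A \<in> sets borel" "\<And>z z'. z \<in> A \<Longrightarrow> z' \<in> A \<Longrightarrow> dist z z' \<le> d"
    "hair N x \<inter> A \<noteq> {}" "k < N" "\<And>j. j < k \<Longrightarrow> d * expansion j x \<le> 1" "1 \<le> d * expansion k x"
  shows "mass N A \<le> ennreal ((\<Prod>i<k. step_const / ((Er lam ^^ Suc i) x * psi ((Er lam ^^ i) x))) *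
           (large_const * (d * expansion k x) * min 1 (d * expansion k x / psi ((Er lam ^^ k) x))))"
  using assms
proof (induction k arbitrary: x A d N)
  case 0
  then obtain N' where "N = Suc N'" by (cases N) auto
  then show ?case using mass_large[of d A x N'] 0 by simp
next
  case (Suc k)
  note x = Suc.prems(1)
  obtain N' where N: "N = Suc N'" "k < N'" using Suc.prems(5) by (cases N) auto
  have d1: "d \<le> 1" using Suc.prems(6)[of 0] by simp
  have ne: "hair (Suc N') x \<inter> A \<noteq> {}" using Suc.prems(4) N by simp
  obtain A' where A': "A' \<in> sets borel"
    "\<And>w w'. w \<in> A' \<Longrightarrow> w' \<in> A' \<Longrightarrow> dist w w' \<le> exp 2 * Er lam x * d"
    "hair N' (Er lam x) \<inter> A' \<noteq> {}"
    "mass (Suc N') A \<le> ennreal (step_const / (Er lam x * psi x)) * mass N' A'"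
    using mass_step[OF Suc.prems(2) d1 Suc.prems(3) x ne] by blast
  let ?d = "exp 2 * Er lam x * d"
  have sc: "?d * expansion j (Er lam x) = d * expansion (Suc j) x" for j
    by (simp add: expansion_Suc_shift)
  define R where "R = (\<Prod>i<k. step_const / ((Er lam ^^ Suc i) (Er lam x) * psi ((Er lam ^^ i) (Er lam x)))) *
           (large_const * (?d * expansion k (Er lam x)) * min 1 (?d * expansion k (Er lam x) / psi ((Er lam ^^ k) (Er lam x))))"
  have "mass N' A' \<le> ennreal R"
    unfolding R_def
  proof (rule Suc.IH[OF Er_ge_a[OF x] A'(1) A'(2) A'(3) N(2)])
    show "?d * expansion j (Er lam x) \<le> 1" if "j < k" for j
      unfolding sc using that by (intro Suc.prems(6)) simp
    show "1 \<le> ?d * expansion k (Er lam x)" unfolding sc by (rule Suc.prems(7))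
  qed auto
  then have "mass N A \<le> ennreal (step_const / (Er lam x * psi x)) * ennreal R"
    using A'(4) N(1) mult_left_mono[of "mass N' A'" "ennreal R" "ennreal (step_const / (Er lam x * psi x))"]
    by (simp add: order_trans)
  also have "\<dots> = ennreal (step_const / (Er lam x * psi x) * R)"
    using step_const_pos Er_pos[OF lam_pos, of x] psi_ge'[OF x] by (intro ennreal_mult'[symmetric]) simp
  also have "step_const / (Er lam x * psi x) * R = (\<Prod>i<Suc k. step_const / ((Er lam ^^ Suc i) x * psi ((Er lam ^^ i) x))) *
           (large_const * (d * expansion (Suc k) x) * min 1 (d * expansion (Suc k) x / psi ((Er lam ^^ Suc k) x)))"
    unfolding R_def sc prod.lessThan_Suc_shift by (simp add: funpow_swap1)
  finally show ?case .
qed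

text \<open>The factors \<open>(Er lam ^^ Suc i) x\<close> cancel against those in
  \<open>expansion\<close>, leaving a constant over \<open>psi\<close> per generation.\<close>

lemma mass_bound_telescoped:
  assumes "a \<le> x" "A \<in> sets borel" "\<And>z z'. z \<in> A \<Longrightarrow> z' \<in> A \<Longrightarrow> dist z z' \<le> d"
    "hair N x \<inter> A \<noteq> {}" "k < N" "\<And>j. j < k \<Longrightarrow> d * expansion j x \<le> 1" "1 \<le> d * expansion k x"
  shows "mass N A \<le> ennreal (large_const * d * (\<Prod>i<k. step_const * exp 2 / psi ((Er lam ^^ i) x)) *
           min 1 (d / (psi ((Er lam ^^ k) x) / expansion k x)))"
proof -
  have "(\<Prod>i<k. step_const / ((Er lam ^^ Suc i) x * psi ((Er lam ^^ i) x))) * expansion k x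
      = (\<Prod>i<k. step_const * exp 2 / psi ((Er lam ^^ i) x))"
    unfolding expansion_def prod.distrib[symmetric]
  proof (rule prod.cong[OF refl])
    fix i
    have "(Er lam ^^ Suc i) x \<noteq> 0" using funpow_Er_pos[OF assms(1), of "Suc i"] by linarith
    then show "step_const / ((Er lam ^^ Suc i) x * psi ((Er lam ^^ i) x)) * (exp 2 * (Er lam ^^ Suc i) x)
        = step_const * exp 2 / psi ((Er lam ^^ i) x)" by (simp del: funpow.simps)
  qed
  then have eq: "(\<Prod>i<k. step_const / ((Er lam ^^ Suc i) x * psi ((Er lam ^^ i) x))) *
      (large_const * (d * expansion k x) * min 1 (d * expansion k x / psi ((Er lam ^^ k) x)))
    = large_const * d * (\<Prod>i<k. step_const * exp 2 / psi ((Er lam ^^ i) x)) *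
           min 1 (d / (psi ((Er lam ^^ k) x) / expansion k x))"
    by (simp add: mult_ac del: funpow.simps)
  show ?thesis unfolding eq[symmetric] by (rule mass_bound[OF assms])
qed

text \<open>The last factor of the product dominates all others. The extra \<open>exp 2\<close> and
  the division by 2 fit the later use, where \<open>1 / w\<close> contains
  \<open>exp 2 * expansion m x\<close> and \<open>ln t\<close> is at least half of the last
  iterate.\<close>

lemma expansion_growth:
  assumes growth: "\<And>y. a \<le> y \<Longrightarrow> exp 2 * Er lam y * (y/2) powr (1 + \<delta>) \<le> (Er lam y / 2) powr (1 + \<delta>)"
    and big: "2 * exp 2 \<le> a" and \<delta>: "0 < \<delta>" and x: "a \<le> x"
  shows "exp 2 * expansion m x \<le> ((Er lam ^^ m) x / 2) powr (1 + \<delta>)"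
proof (induction m)
  case 0
  have "exp 2 \<le> x / 2" using big x by simp
  also have "x/2 = (x/2) powr 1" using x a_ge by simp
  also have "\<dots> \<le> (x/2) powr (1 + \<delta>)" using x a_ge \<delta> by (intro powr_mono) auto
  finally show ?case by simp
next
  case (Suc m)
  let ?y = "(Er lam ^^ m) x"
  have y: "a \<le> ?y" using x by (rule Er_funpow_ge)
  have "exp 2 * expansion (Suc m) x = (exp 2 * Er lam ?y) * (exp 2 * expansion m x)"
    by (simp add: expansion_Suc)
  also have "\<dots> \<le> (exp 2 * Er lam ?y) * (?y / 2) powr (1 + \<delta>)"
    using Suc.IH Er_pos[OF lam_pos, of ?y] by (intro mult_left_mono) auto
  also have "\<dots> \<le> (Er lam ?y / 2) powr (1 + \<delta>)" by (rule growth[OF y])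
  finally show ?case by simp
qed

text \<open>The number of steps until the set has size 1 is bounded in terms of \<open>d\<close>
  alone, hence one \<open>N0\<close> for all \<open>A\<close> and \<open>x\<close>. Of the factors
  \<open>D / psi\<close>, the last cancels the value of \<open>p\<close>; the others are at most 1/2
  and produce \<open>\<epsilon>\<close>.\<close>

lemma mass_small:
  fixes h p :: "real \<Rightarrow> real" and t0 \<delta> \<epsilon> b :: real
  assumes t0: "0 < t0" and \<delta>: "0 < \<delta>" and \<epsilon>: "0 < \<epsilon>" and b: "a \<le> b"
    and h_def: "\<forall>t\<in>{0<..<t0}. h t = t / p (1 / t)"
    and p_mono: "mono_on {1 / t0<..} p" and p_pos: "\<forall>s>1 / t0. p s > 0"
    and tp_mono: "mono_on {0<..<t0} (\<lambda>t. t * p (1 / t))"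
    and p_le: "\<And>t. a \<le> t \<Longrightarrow> p (t * ln t powr (1 + \<delta>) / psi t) \<le> psi (ln t)"
    and growth: "\<And>y. a \<le> y \<Longrightarrow> exp 2 * Er lam y * (y/2) powr (1 + \<delta>) \<le> (Er lam y / 2) powr (1 + \<delta>)"
    and big: "2 * exp 2 \<le> a" and psi_big: "2 * (step_const * exp 2) \<le> psi a"
  obtains \<eta> where "0 < \<eta>" "\<eta> \<le> t0"
    "\<And>d. 0 < d \<Longrightarrow> d < \<eta> \<Longrightarrow> \<exists>N0. \<forall>N\<ge>N0. \<forall>A x. a \<le> x \<and> x \<le> b \<and> A \<in> sets borel \<and>
       (\<forall>z\<in>A. \<forall>z'\<in>A. dist z z' \<le> d) \<and> hair N x \<inter> A \<noteq> {} \<longrightarrow> mass N A \<le> ennreal (\<epsilon> * h d)"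
proof -
  define D where "D = step_const * exp 2"
  have D0: "0 < D" using step_const_pos by (simp add: D_def)
  have "\<exists>k. (1/2::real)^k < min t0 (\<epsilon> / (large_const * D))"
    using t0 \<epsilon> large_const_pos D0 by (intro real_arch_pow_inv) auto
  then obtain k0 where k0: "(1/2::real)^k0 < t0" "(1/2::real)^k0 < \<epsilon> / (large_const * D)"
    using t0 by auto
  define \<eta> where "\<eta> = min t0 (1 / expansion (Suc k0) b)"
  have "0 < \<eta>" using t0 expansion_pos[OF b] by (simp add: \<eta>_def)
  moreover have "\<eta> \<le> t0" by (simp add: \<eta>_def)
  moreover have "\<exists>N0. \<forall>N\<ge>N0. \<forall>A x. a \<le> x \<and> x \<le> b \<and> A \<in> sets borel \<and>
       (\<forall>z\<in>A. \<forall>z'\<in>A. dist z z' \<le> d) \<and> hair N x \<inter> A \<noteq> {} \<longrightarrow> mass N A \<le> ennreal (\<epsilon> * h d)"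
    if d: "0 < d" "d < \<eta>" for d
  proof -
    obtain k1 where k1: "1 / d < 2 ^ k1" using real_arch_pow[of 2 "1/d"] by auto
    have "mass N A \<le> ennreal (\<epsilon> * h d)"
      if N: "Suc k1 \<le> N" and x: "a \<le> x" "x \<le> b" and A: "A \<in> sets borel"
        and diam: "\<forall>z\<in>A. \<forall>z'\<in>A. dist z z' \<le> d" and ne: "hair N x \<inter> A \<noteq> {}" for N A x
    proof -
      let ?x = "\<lambda>i. (Er lam ^^ i) x"
      have "1 / d \<le> expansion k1 x" using k1 expansion_ge[OF x(1), of k1] by linarith
      then have e1: "1 \<le> d * expansion k1 x" using d by (simp add: field_simps)
      define k where "k = (LEAST k. 1 \<le> d * expansion k x)"
      have k: "1 \<le> d * expansion k x" unfolding k_def by (rule LeastI[of _ k1]) (rule e1)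
      have kmin: "d * expansion j x \<le> 1" if "j < k" for j
        using not_less_Least[of j "\<lambda>k. 1 \<le> d * expansion k x"] that by (simp add: k_def)
      have "k \<le> k1" unfolding k_def using e1 by (rule Least_le)
      then have kN: "k < N" using N by simp
      \<comment> \<open>A small \<open>d\<close> needs many steps, uniformly in
        \<open>x \<le> b\<close>; this supplies the \<open>k0\<close> factors 1/2.\<close>
      have "\<not> k \<le> Suc k0"
      proof
        assume "k \<le> Suc k0"
        then have "d * expansion k x \<le> d * expansion (Suc k0) b"
          using x d by (intro mult_left_mono expansion_mono) auto
        also have "\<dots> < 1" using d expansion_pos[OF b, of "Suc k0"] by (simp add: \<eta>_def field_simps)
        finally show False using k by simp
      qed
      then obtain m where m: "k = Suc m" "k0 \<le> m" by (cases k) auto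
      define t where "t = ?x k"
      have ym: "a \<le> ?x m" by (rule Er_funpow_ge[OF x(1)])
      have t_eq: "t = Er lam (?x m)" by (simp add: t_def m)
      have ta: "a \<le> t" unfolding t_def by (rule Er_funpow_ge[OF x(1)])
      have t8: "8 \<le> t" using ta a_ge by simp
      have lnt: "?x m / 2 \<le> ln t" "ln t \<le> ?x m" unfolding t_eq using ln_Er_bounds[OF ym] by auto
      have psit: "8 \<le> psi t" "psi t \<le> t / 8" using psi_ge'[OF ta] psi_small[OF ta] by auto
      define w where "w = psi t / expansion k x"
      have ex: "expansion k x = expansion m x * (exp 2 * t)" by (simp add: m expansion_Suc t_eq)
      have exm: "2 ^ m \<le> expansion m x" by (rule expansion_ge[OF x(1)])
      have w0: "0 < w" using psit expansion_pos[OF x(1), of k] by (simp add: w_def)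
      have "w \<le> (1/2)^m"
      proof -
        have "2 ^ m * psi t \<le> expansion m x * (exp 2 * t)"
          using exm psit t8 mult_mono[of 1 "exp 2::real" "psi t" t] expansion_pos[OF x(1), of m]
          by (intro mult_mono) auto
        then show ?thesis using expansion_pos[OF x(1), of k] by (simp add: w_def ex field_simps power_one_over)
      qed
      also have "\<dots> \<le> (1/2)^k0" using m(2) by (intro power_decreasing) auto
      finally have wt0: "w < t0" using k0(1) by linarith
      have "exp 2 * expansion m x \<le> (?x m / 2) powr (1 + \<delta>)" by (rule expansion_growth[OF growth big \<delta> x(1)])
      also have "\<dots> \<le> ln t powr (1 + \<delta>)" using lnt ym a_ge \<delta> by (intro powr_mono2) auto
      finally have "t * (exp 2 * expansion m x) / psi t \<le> t * ln t powr (1 + \<delta>) / psi t"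
        using t8 psit by (intro divide_right_mono mult_left_mono) auto
      moreover have "1 / w = t * (exp 2 * expansion m x) / psi t" by (simp add: w_def ex mult_ac)
      ultimately have "1 / w \<le> t * ln t powr (1 + \<delta>) / psi t" by simp
      moreover have w1: "1 / t0 < 1 / w" using w0 wt0 by (simp add: frac_less2)
      ultimately have "p (1 / w) \<le> p (t * ln t powr (1 + \<delta>) / psi t)"
        by (intro mono_onD[OF p_mono]) auto
      also have "\<dots> \<le> psi (ln t)" by (rule p_le[OF ta])
      also have "\<dots> \<le> psi (?x m)" by (rule psi_le[OF lnt(2)])
      finally have pw: "p (1 / w) \<le> psi (?x m)" .
      have dt0: "d < t0" using d by (simp add: \<eta>_def)
      have d1: "1 / t0 < 1 / d" using d dt0 by (simp add: frac_less2)
      have pd: "0 < p (1 / d)" using p_pos d1 by blast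
      \<comment> \<open>For \<open>d\<close> above \<open>w\<close> monotonicity of \<open>p\<close>
        suffices; below \<open>w\<close>, that of \<open>t * p (1 / t)\<close> uses up the factor
        \<open>d / w\<close>.\<close>
      have pmin: "p (1 / d) * min 1 (d / w) \<le> psi (?x m)"
      proof (cases "w \<le> d")
        case True
        then have "p (1 / d) \<le> p (1 / w)"
          using d d1 w1 w0 by (intro mono_onD[OF p_mono]) (auto simp: frac_le)
        moreover have "p (1 / d) * min 1 (d / w) \<le> p (1 / d) * 1" using pd by (intro mult_left_mono) auto
        ultimately show ?thesis using pw by linarith
      next
        case False
        then have "d * p (1 / d) \<le> w * p (1 / w)"
          using mono_onD[OF tp_mono, of d w] d w0 wt0 dt0 by simp
        then have "p (1 / d) * (d / w) \<le> p (1 / w)" using w0 by (simp add: field_simps)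
        moreover have "p (1 / d) * min 1 (d / w) \<le> p (1 / d) * (d / w)" using pd by (intro mult_left_mono) auto
        ultimately show ?thesis using pw by linarith
      qed
      have pos: "0 < psi (?x i)" for i using psi_ge'[OF Er_funpow_ge[OF x(1), of i]] by simp
      have "(\<Prod>i<m. D / psi (?x i)) \<le> (\<Prod>i<m. 1/2)"
      proof (rule prod_mono)
        fix i
        have "2 * D \<le> psi (?x i)" using psi_big psi_le[OF Er_funpow_ge[OF x(1), of i]] by (simp add: D_def)
        then show "0 \<le> D / psi (?x i) \<and> D / psi (?x i) \<le> 1/2" using D0 pos[of i] by (simp add: field_simps)
      qed
      also have "\<dots> \<le> (1/2)^k0" using m(2) by (simp add: power_decreasing)
      finally have "(\<Prod>i<m. D / psi (?x i)) * (D / psi (?x m)) \<le> (1/2)^k0 * (D / psi (?x m))"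
        using D0 pos[of m] by (intro mult_right_mono) auto
      then have prd: "(\<Prod>i<k. D / psi (?x i)) \<le> (1/2)^k0 * (D / psi (?x m))" by (simp add: m)
      have mm: "0 \<le> min 1 (d / w)" using d w0 by simp
      have "mass N A \<le> ennreal (large_const * d * (\<Prod>i<k. D / psi (?x i)) * min 1 (d / w))"
        unfolding D_def w_def t_def using diam by (intro mass_bound_telescoped[OF x(1) A _ ne kN kmin k]) auto
      also have "\<dots> \<le> ennreal (\<epsilon> * h d)"
      proof (rule ennreal_leI)
        have "large_const * d * (\<Prod>i<k. D / psi (?x i)) * min 1 (d / w)
            \<le> large_const * d * ((1/2)^k0 * (D / psi (?x m))) * min 1 (d / w)"
          using prd mm large_const_pos d by (intro mult_right_mono mult_left_mono) auto
        also have "\<dots> \<le> large_const * d * ((1/2)^k0 * (D / psi (?x m))) * (psi (?x m) / p (1 / d))"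
          using pmin pd large_const_pos d D0 pos[of m] by (intro mult_left_mono) (auto simp: field_simps)
        also have "\<dots> = (large_const * D * (1/2)^k0) * (d / p (1 / d))" using pos[of m] by simp
        also have "\<dots> \<le> \<epsilon> * (d / p (1 / d))"
          using k0(2) large_const_pos D0 d pd by (intro mult_right_mono) (auto simp: field_simps)
        also have "\<dots> = \<epsilon> * h d" using h_def d dt0 by simp
        finally show "large_const * d * (\<Prod>i<k. D / psi (?x i)) * min 1 (d / w) \<le> \<epsilon> * h d" .
      qed
      finally show ?thesis .
    qed
    then show ?thesis by (intro exI[of _ "Suc k1"]) blast
  qed
  ultimately show ?thesis using that by blast
qed

end

section \<open>The lower estimate\<close>

lemma gauge_hausdorff_mono:
  assumes "A \<subseteq> B"
  shows "gauge_hausdorff h t0 A \<le> gauge_hausdorff h t0 B"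
  unfolding gauge_hausdorff_def using assms by (intro SUP_mono' INF_superset_mono) auto

lemma gauge_hausdorff_eq_top:
  fixes A :: "'a::metric_space set"
  assumes "\<And>B. 0 < B \<Longrightarrow> \<exists>\<eta>\<in>{0<..<t0}. \<forall>C. A \<subseteq> (\<Union>k::nat. C k) \<longrightarrow>
      (\<forall>k. bounded (C k) \<and> diameter (C k) < \<eta>) \<longrightarrow> ennreal B \<le> (\<Sum>k. gauge_term h (C k))"
  shows "gauge_hausdorff h t0 A = \<infinity>"
proof -
  have "ennreal B \<le> gauge_hausdorff h t0 A" if "0 < B" for B
  proof -
    obtain \<eta> where "\<eta> \<in> {0<..<t0}" "\<forall>C. A \<subseteq> (\<Union>k::nat. C k) \<longrightarrow>
      (\<forall>k. bounded (C k) \<and> diameter (C k) < \<eta>) \<longrightarrow> ennreal B \<le> (\<Sum>k. gauge_term h (C k))"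
      using assms[OF \<open>0 < B\<close>] by blast
    then show ?thesis unfolding gauge_hausdorff_def
      by (intro SUP_upper2[of \<eta>] INF_greatest) auto
  qed
  note * = this
  show ?thesis
  proof (cases "gauge_hausdorff h t0 A")
    case (real r)
    then show ?thesis using *[of "r + 1"] by simp
  qed simp
qed

section \<open>Compactness of the hairs of late generations\<close>

context exp_strip
begin

text \<open>Keeping all generations from \<open>N\<close> on makes the sets decrease with
  \<open>N\<close>. Starting at \<open>a + 2\<close> gives a margin of 2 over the iterates of
  \<open>a\<close>; hair bounds and closure use 3/2 of it.\<close>

definition hairs :: "nat \<Rightarrow> complex set" where
  "hairs N = (\<Union>m\<in>{N..}. \<Union>x\<in>{a + 2..a + 3}. hair m x)"

lemma hairsI: "z \<in> hair m x \<Longrightarrow> N \<le> m \<Longrightarrow> a + 2 \<le> x \<Longrightarrow> x \<le> a + 3 \<Longrightarrow> z \<in> hairs N"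
  unfolding hairs_def by (intro UN_I[of m] UN_I[of x]) auto

lemma hairsE:
  assumes "z \<in> hairs N"
  obtains m x where "z \<in> hair m x" "N \<le> m" "a + 2 \<le> x" "x \<le> a + 3"
  using assms unfolding hairs_def by auto

lemma Er_funpow_expand:
  assumes "a \<le> x"
  shows "(Er lam ^^ j) x + 2 \<le> (Er lam ^^ j) (x + 2)"
proof (induction j)
  case (Suc j)
  let ?y = "(Er lam ^^ j) x"
  have y: "a \<le> ?y" using assms by (rule Er_funpow_ge)
  have "1 \<le> Er lam ?y" using Er_ge_a[OF y] a_ge by simp
  then have "Er lam ?y + 2 \<le> Er lam ?y * (1 + 2)" by simp
  also have "\<dots> \<le> Er lam ?y * exp 2"
    using exp_ge_add_one_self[of "2::real"] Er_pos[OF lam_pos, of ?y] by (intro mult_left_mono) auto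
  also have "\<dots> = Er lam (?y + 2)" by (simp add: Er_add)
  also have "\<dots> \<le> Er lam ((Er lam ^^ j) (x + 2))" using Suc.IH lam_pos by (intro Er_mono)
  finally show ?case by simp
qed simp

lemma isCont_E_map_funpow: "isCont (E_map lam ^^ j) z"
proof (induction j)
  case (Suc j)
  have "isCont (E_map lam) ((E_map lam ^^ j) z)" unfolding E_map_def[abs_def] by (intro continuous_intros)
  then have "isCont (E_map lam \<circ> (E_map lam ^^ j)) z" using Suc by (rule continuous_at_compose[rotated])
  then show ?case by (simp add: o_def)
qed (simp add: id_def)

text \<open>For each \<open>j\<close>, points of generation at least \<open>j\<close> lie near
  \<open>z\<close>, and their \<open>j\<close>-th iterates obey the hair bounds. By continuity the
  iterate of \<open>z\<close> differs by at most 1/2, which the margins absorb, so the strict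
  inequalities survive.\<close>

lemma Inter_closure_hairs_subset: "(\<Inter>N. closure (hairs N)) \<subseteq> Xset lam a psi"
proof
  fix z assume z: "z \<in> (\<Inter>N. closure (hairs N))"
  show "z \<in> Xset lam a psi"
    unfolding Xset_alt
  proof
    fix j
    let ?w = "(E_map lam ^^ j) z"
    obtain \<rho> where \<rho>: "0 < \<rho>" "\<And>z'. dist z' z < \<rho> \<Longrightarrow> dist ((E_map lam ^^ j) z') ?w < 1/2"
      using isCont_E_map_funpow[of z j] unfolding continuous_at_eps_delta by (meson half_gt_zero zero_less_one)
    obtain z' where z': "z' \<in> hairs j" "dist z' z < \<rho>"
      using z \<rho>(1) closure_approachable[of z "hairs j"] by blast
    then obtain m x where mx: "j \<le> m" "a + 2 \<le> x" "x \<le> a + 3" "z' \<in> hair m x"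
      by (auto simp: hairs_def)
    let ?w' = "(E_map lam ^^ j) z'" and ?y = "(Er lam ^^ j) x"
    have ax: "a \<le> x" using mx by simp
    have ya: "a \<le> ?y" using ax by (rule Er_funpow_ge)
    have w': "?w' \<in> hair (m - j) ?y" using mx ax by (intro E_map_funpow_hair) auto
    have "norm (?w' - ?w) \<le> 1/2" using \<rho>(2)[OF z'(2)] by (simp add: dist_norm)
    then have d: "\<bar>Re ?w' - Re ?w\<bar> \<le> 1/2" "\<bar>Im ?w' - Im ?w\<bar> \<le> 1/2"
      using abs_Re_le_cmod[of "?w' - ?w"] abs_Im_le_cmod[of "?w' - ?w"] by auto
    note b = hair_bounds[OF ya w']
    have "(Er lam ^^ j) a + 2 \<le> (Er lam ^^ j) (a + 2)" by (rule Er_funpow_expand) simp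
    also have "\<dots> \<le> ?y" using lam_pos mx(2) by (rule Er_funpow_mono)
    finally have y2: "(Er lam ^^ j) a + 2 \<le> ?y" .
    have re: "(Er lam ^^ j) a < Re ?w" using y2 b(1) d(1) by linarith
    have a1: "a \<le> (Er lam ^^ j) a" by (rule Er_funpow_ge) simp
    have Ra: "a < Re ?w" using re a1 by linarith
    have "psi ?y \<le> psi (2 * Re ?w)" using b(1) d(1) Ra a_ge by (intro psi_le) linarith
    also have "\<dots> \<le> C * psi (Re ?w)" using Ra a_ge by (intro doubling) linarith
    \<comment> \<open>The factor \<open>C\<close> in the denominator of \<open>branch_max\<close> is
      spent here.\<close>
    finally have "psi ?y / (2 * C) \<le> C * psi (Re ?w) / (2 * C)" using C_ge by (intro divide_right_mono) auto
    then have "psi ?y / (2 * C) \<le> psi (Re ?w) / 2" using C_ge by simp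
    moreover have "8 \<le> psi (Re ?w)" using Ra by (intro psi_ge') simp
    ultimately have "\<bar>Im ?w\<bar> < psi (Re ?w)" using b(2) d(2) by linarith
    then show "(Er lam ^^ j) a < Re ?w \<and> a < Re ?w \<and> \<bar>Im ?w\<bar> < psi (Re ?w)" using re Ra by blast
  qed
qed

lemma compact_closure_hairs: "compact (closure (hairs N))"
proof -
  have "norm z \<le> 2 * (a + 3)" if zN: "z \<in> hairs N" for z
  proof -
    obtain m x where mx: "a + 2 \<le> x" "x \<le> a + 3" "z \<in> hair m x"
      using zN by (auto simp: hairs_def)
    have "dist z (of_real x) \<le> x / 2" using mx by (intro hair_near) auto
    then show ?thesis using norm_triangle_sub[of z "of_real x"] mx a_ge by (simp add: dist_norm)
  qed
  then have "bounded (hairs N)" unfolding bounded_iff by blast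
  then show ?thesis by (simp add: compact_closure)
qed

text \<open>Otherwise the closures minus the open union would be nonempty nested compact sets, and a
  common point would be an uncovered point of the set.\<close>

lemma hairs_finite_subcover:
  fixes U :: "nat \<Rightarrow> complex set"
  assumes "\<And>k. open (U k)" "Xset lam a psi \<subseteq> (\<Union>k. U k)"
  obtains N I where "finite I" "closure (hairs N) \<subseteq> (\<Union>k\<in>I. U k)"
proof -
  define V where "V = (\<Union>k. U k)"
  have "open V" using assms(1) by (auto simp: V_def)
  have "\<exists>N. closure (hairs N) - V = {}"
  proof (rule ccontr)
    assume "\<not> ?thesis"
    then have ne: "closure (hairs N) - V \<noteq> {}" for N by blast
    have "\<Inter> (range (\<lambda>N. closure (hairs N) - V)) \<noteq> {}"
    proof (rule compact_nest)
      show "compact (closure (hairs N) - V)" for N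
        using compact_closure_hairs \<open>open V\<close> by (rule compact_diff)
      show "closure (hairs n) - V \<subseteq> closure (hairs m) - V" if "m \<le> n" for m n
      proof -
        have "hairs n \<subseteq> hairs m" using that by (auto elim!: hairsE intro: hairsI)
        then show ?thesis using closure_mono by blast
      qed
    qed (rule ne)
    then show False using Inter_closure_hairs_subset assms(2) by (auto simp: V_def)
  qed
  then obtain N where N: "closure (hairs N) \<subseteq> (\<Union>k\<in>UNIV. U k)" by (auto simp: V_def)
  obtain I where "I \<subseteq> UNIV" "finite I" "closure (hairs N) \<subseteq> (\<Union>k\<in>I. U k)"
    by (rule compactE_image[OF compact_closure_hairs _ N]) (use assms(1) in auto)
  then show ?thesis using that by blast
qed

text \<open>The interval \<open>{a + 2..a + 3}\<close> has length 1 and the average of the constant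
  1 is 1. A set that meets no hair over this interval contributes 0, so \<open>le\<close> is asked
  only of the others.\<close>

lemma mass_cover:
  assumes I: "finite I" and U: "\<And>k. k \<in> I \<Longrightarrow> U k \<in> sets borel"
    and sub: "hairs N \<subseteq> (\<Union>k\<in>I. U k)" "N \<le> n"
    and le: "\<And>k x. k \<in> I \<Longrightarrow> a \<le> x \<Longrightarrow> x \<le> a + 3 \<Longrightarrow> hair n x \<inter> U k \<noteq> {} \<Longrightarrow> mass n (U k) \<le> g k"
  shows "1 \<le> (\<Sum>k\<in>I. g k)"
proof -
  let ?J = "{a + 2..a + 3}"
  have "1 = (\<integral>\<^sup>+x. indicator ?J x \<partial>lborel)" by simp
  also have "\<dots> \<le> (\<integral>\<^sup>+x. (\<Sum>k\<in>I. ennreal (avg n (indicator (U k)) x) * indicator ?J x) \<partial>lborel)"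
  proof (intro nn_integral_mono)
    fix x
    show "indicator ?J x \<le> (\<Sum>k\<in>I. ennreal (avg n (indicator (U k)) x) * indicator ?J x)"
    proof (cases "x \<in> ?J")
      case True
      then have x: "a \<le> x" by simp
      have "avg n (\<lambda>_. 1) x \<le> avg n (\<lambda>z. \<Sum>k\<in>I. indicator (U k) z) x"
      proof (rule avg_mono[OF x])
        fix z assume "z \<in> hair n x"
        then have "z \<in> hairs N" using True sub(2) by (intro hairsI) auto
        then obtain k where k: "k \<in> I" "z \<in> U k" using sub(1) by blast
        then have "(1::real) = indicator (U k) z" by simp
        also have "\<dots> \<le> (\<Sum>k\<in>I. indicator (U k) z)" using I k by (intro member_le_sum) auto
        finally show "(1::real) \<le> (\<Sum>k\<in>I. indicator (U k) z)" .
      qed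
      then have "1 \<le> (\<Sum>k\<in>I. avg n (indicator (U k)) x)"
        by (simp add: avg_const[OF x] avg_sum)
      then have "ennreal 1 \<le> ennreal (\<Sum>k\<in>I. avg n (indicator (U k)) x)" by (rule ennreal_leI)
      also have "\<dots> = (\<Sum>k\<in>I. ennreal (avg n (indicator (U k)) x))"
        using avg_indicator_ge_0[OF x] by (intro sum_ennreal[symmetric])
      finally show ?thesis using True by simp
    qed simp
  qed
  also have "\<dots> = (\<Sum>k\<in>I. \<integral>\<^sup>+x. ennreal (avg n (indicator (U k)) x) * indicator ?J x \<partial>lborel)"
  proof (rule nn_integral_sum)
    fix k assume "k \<in> I"
    note [measurable] = U[OF this]
    show "(\<lambda>x. ennreal (avg n (indicator (U k)) x) * indicator ?J x) \<in> borel_measurable lborel"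
      by measurable
  qed
  also have "\<dots> \<le> (\<Sum>k\<in>I. g k)"
  proof (rule sum_mono)
    fix k assume k: "k \<in> I"
    show "(\<integral>\<^sup>+x. ennreal (avg n (indicator (U k)) x) * indicator ?J x \<partial>lborel) \<le> g k"
    proof (cases "\<exists>x\<in>?J. hair n x \<inter> U k \<noteq> {}")
      case True
      then obtain x where x: "x \<in> ?J" "hair n x \<inter> U k \<noteq> {}" by blast
      have "(\<integral>\<^sup>+x. ennreal (avg n (indicator (U k)) x) * indicator ?J x \<partial>lborel) \<le> mass n (U k)"
        unfolding mass_def by (intro nn_integral_mono mult_left_mono) (auto simp: indicator_def)
      also have "\<dots> \<le> g k" using x by (intro le[OF k, of x]) auto
      finally show ?thesis .
    next
      case False
      have "ennreal (avg n (indicator (U k)) x) * indicator ?J x = 0" for x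
      proof (cases "x \<in> ?J")
        case True
        then have "hair n x \<inter> U k = {}" using False by blast
        then show ?thesis using avg_indicator_eq_0[of x n "U k"] True by simp
      qed simp
      then show ?thesis by (simp only: nn_integral_const) simp
    qed
  qed
  finally show ?thesis .
qed

text \<open>Covering sets are enlarged to open balls of four times the diameter, at the cost of a
  factor 16 in the gauge. Sets of diameter 0, which count as 0, become balls of total gauge at most
  1.\<close>

lemma gauge_infinite_Xset:
  fixes h p :: "real \<Rightarrow> real" and t0 \<delta> :: real
  assumes t0: "0 < t0" and \<delta>: "0 < \<delta>"
    and h_def: "\<forall>t\<in>{0<..<t0}. h t = t / p (1 / t)"
    and p_mono: "mono_on {1 / t0<..} p" and p_pos: "\<forall>s>1 / t0. p s > 0"
    and tp_mono: "mono_on {0<..<t0} (\<lambda>t. t * p (1 / t))"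
    and h_pos: "\<forall>t\<in>{0<..<t0}. h t > 0" and h_lim: "(h \<longlongrightarrow> 0) (at_right 0)"
    and p_le: "\<And>t. a \<le> t \<Longrightarrow> p (t * ln t powr (1 + \<delta>) / psi t) \<le> psi (ln t)"
    and growth: "\<And>y. a \<le> y \<Longrightarrow> exp 2 * Er lam y * (y/2) powr (1 + \<delta>) \<le> (Er lam y / 2) powr (1 + \<delta>)"
    and big: "2 * exp 2 \<le> a" and psi_big: "2 * (step_const * exp 2) \<le> psi a"
  shows "gauge_hausdorff h t0 (Xset lam a psi) = \<infinity>"
proof (rule gauge_hausdorff_eq_top)
  fix B :: real assume B: "0 < B"
  \<comment> \<open>Chosen so that \<open>\<epsilon> * (16 * B + 1) < 1\<close>, which gives the
    final contradiction.\<close>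
  define \<epsilon> where "\<epsilon> = 1 / (16 * B + 2)"
  have \<epsilon>: "0 < \<epsilon>" using B by (simp add: \<epsilon>_def)
  obtain \<eta> where \<eta>: "0 < \<eta>" "\<eta> \<le> t0" and small:
    "\<And>d. 0 < d \<Longrightarrow> d < \<eta> \<Longrightarrow> \<exists>N0. \<forall>N\<ge>N0. \<forall>A x. a \<le> x \<and> x \<le> a + 3 \<and> A \<in> sets borel \<and>
       (\<forall>z\<in>A. \<forall>z'\<in>A. dist z z' \<le> d) \<and> hair N x \<inter> A \<noteq> {} \<longrightarrow> mass N A \<le> ennreal (\<epsilon> * h d)"
    by (rule mass_small[OF t0 \<delta> \<epsilon> _ h_def p_mono p_pos tp_mono p_le growth big psi_big, of "a + 3"]) auto
  have "ennreal B \<le> (\<Sum>k. gauge_term h (S k))"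
    if cover: "Xset lam a psi \<subseteq> (\<Union>k::nat. S k)" and S: "\<forall>k. bounded (S k) \<and> diameter (S k) < \<eta> / 4" for S
  proof (rule ccontr)
    assume "\<not> ?thesis"
    then have less: "(\<Sum>k. gauge_term h (S k)) < ennreal B" by simp
    have "\<exists>\<rho>. 0 < \<rho> \<and> \<rho> < \<eta> \<and> h \<rho> < (1/2)^Suc k" for k
    proof -
      have "\<forall>\<^sub>F \<rho> in at_right 0. h \<rho> < (1/2)^Suc k" using h_lim by (rule order_tendstoD) simp
      then have "\<forall>\<^sub>F \<rho> in at_right 0. h \<rho> < (1/2)^Suc k \<and> \<rho> \<in> {0<..<\<eta>}"
        using \<eta>(1) by (intro eventually_conj eventually_at_right_real)
      then have "\<exists>\<rho>. h \<rho> < (1/2)^Suc k \<and> \<rho> \<in> {0<..<\<eta>}"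
        by (rule eventually_happens'[rotated]) simp
      then show ?thesis by auto
    qed
    then obtain \<rho> where \<rho>: "\<And>k. 0 < \<rho> k" "\<And>k. \<rho> k < \<eta>" "\<And>k. h (\<rho> k) < (1/2)^Suc k" by metis
    define d where "d k = (if diameter (S k) = 0 then \<rho> k else 4 * diameter (S k))" for k
    define c where "c k = (SOME z. z \<in> S k)" for k
    define U where "U k = ball (c k) (d k / 2)" for k
    have diam0: "0 \<le> diameter (S k)" for k using S diameter_ge_0 by blast
    have d0: "0 < d k" "d k < \<eta>" for k
      using \<rho>(1,2)[of k] diam0[of k] S[rule_format, of k] by (auto simp: d_def)
    have SU: "S k \<subseteq> U k" for k
    proof
      fix z assume z: "z \<in> S k"
      then have "c k \<in> S k" unfolding c_def by (rule someI)
      then have "dist (c k) z \<le> diameter (S k)" using z S diameter_bounded_bound by blast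
      then show "z \<in> U k" using d0(1)[of k] diam0[of k] by (auto simp: U_def d_def split: if_splits)
    qed
    have hd: "ennreal (h (d k)) \<le> 16 * gauge_term h (S k) + ennreal ((1/2)^Suc k)" for k
    proof (cases "diameter (S k) = 0")
      case True
      then show ?thesis using \<rho>(3)[of k] by (auto simp: d_def intro: ennreal_leI)
    next
      case False
      have "h (d k) \<le> (1 / (1/4)^2) * h ((1/4) * d k)"
        using d0[of k] \<eta> by (intro gauge_scaling[OF h_def p_pos tp_mono]) auto
      also have "\<dots> = 16 * h (diameter (S k))" using False by (simp add: d_def power2_eq_square)
      finally have "ennreal (h (d k)) \<le> ennreal (16 * h (diameter (S k)))" by (rule ennreal_leI)
      also have "\<dots> = 16 * gauge_term h (S k)" using False by (simp add: ennreal_mult')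
      finally show ?thesis by (simp add: add_increasing2)
    qed
    have "Xset lam a psi \<subseteq> (\<Union>k. U k)" using cover SU by blast
    moreover have "open (U k)" for k by (simp add: U_def)
    ultimately obtain N I where NI: "finite I" "closure (hairs N) \<subseteq> (\<Union>k\<in>I. U k)"
      using hairs_finite_subcover by metis
    let ?Q = "\<lambda>k N0. \<forall>N\<ge>N0. \<forall>A x. a \<le> x \<and> x \<le> a + 3 \<and> A \<in> sets borel \<and>
       (\<forall>z\<in>A. \<forall>z'\<in>A. dist z z' \<le> d k) \<and> hair N x \<inter> A \<noteq> {} \<longrightarrow> mass N A \<le> ennreal (\<epsilon> * h (d k))"
    have "\<forall>k. \<exists>N0. ?Q k N0" by (intro allI small d0)
    from choice[OF this] obtain N0 where N0: "\<forall>k. ?Q k (N0 k)" ..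
    define n where "n = Max (insert N (N0 ` I))"
    have n: "N \<le> n" "\<And>k. k \<in> I \<Longrightarrow> N0 k \<le> n" using NI(1) by (auto simp: n_def)
    have "1 \<le> (\<Sum>k\<in>I. ennreal (\<epsilon> * h (d k)))"
    proof (rule mass_cover[OF NI(1), of U N n])
      show "hairs N \<subseteq> (\<Union>k\<in>I. U k)" using NI(2) closure_subset by blast
      fix k x assume k: "k \<in> I" "a \<le> x" "x \<le> a + 3" "hair n x \<inter> U k \<noteq> {}"
      have "\<forall>z\<in>U k. \<forall>z'\<in>U k. dist z z' \<le> d k"
      proof (intro ballI)
        fix z z' assume "z \<in> U k" "z' \<in> U k"
        then show "dist z z' \<le> d k"
          unfolding U_def mem_ball using dist_triangle2[of z z' "c k"] by (simp add: dist_commute)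
      qed
      then show "mass n (U k) \<le> ennreal (\<epsilon> * h (d k))"
        using k n(2)[OF k(1)] by (intro N0[rule_format, of k n x "U k"] conjI) (auto simp: U_def)
    qed (use n in \<open>auto simp: U_def\<close>)
    also have "\<dots> = (\<Sum>k\<in>I. ennreal \<epsilon> * ennreal (h (d k)))" using \<epsilon> by (simp add: ennreal_mult')
    also have "\<dots> = ennreal \<epsilon> * (\<Sum>k\<in>I. ennreal (h (d k)))" by (rule sum_distrib_left[symmetric])
    also have "\<dots> \<le> ennreal \<epsilon> * (\<Sum>k. ennreal (h (d k)))"
      using NI(1) by (intro mult_left_mono sum_le_suminf) auto
    also have "\<dots> \<le> ennreal \<epsilon> * (\<Sum>k. 16 * gauge_term h (S k) + ennreal ((1/2)^Suc k))"
      by (intro mult_left_mono suminf_le hd) auto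
    also have "(\<Sum>k. 16 * gauge_term h (S k) + ennreal ((1/2)^Suc k))
        = 16 * (\<Sum>k. gauge_term h (S k)) + (\<Sum>k. ennreal ((1/2)^Suc k))"
      by (subst suminf_add[symmetric]) (auto simp: ennreal_suminf_cmult)
    also have "(\<Sum>k. ennreal ((1/2)^Suc k)) = ennreal 1"
      using power_half_series by (intro suminf_ennreal_eq) auto
    also have "ennreal \<epsilon> * (16 * (\<Sum>k. gauge_term h (S k)) + ennreal 1) \<le> ennreal \<epsilon> * (16 * ennreal B + ennreal 1)"
      using less by (intro mult_left_mono add_right_mono) (auto intro: less_imp_le)
    also have "\<dots> = ennreal (\<epsilon> * (16 * B + 1))"
      using B \<epsilon> by (simp add: ennreal_mult' ennreal_plus)
    finally have "1 \<le> ennreal (\<epsilon> * (16 * B + 1))" .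
    then have "1 \<le> \<epsilon> * (16 * B + 1)" by simp
    then show False using B by (simp add: \<epsilon>_def field_simps)
  qed
  then show "\<exists>\<eta>\<in>{0<..<t0}. \<forall>C. Xset lam a psi \<subseteq> (\<Union>k::nat. C k) \<longrightarrow>
      (\<forall>k. bounded (C k) \<and> diameter (C k) < \<eta>) \<longrightarrow> ennreal B \<le> (\<Sum>k. gauge_term h (C k))"
    using \<eta> t0 by (intro bexI[of _ "\<eta>/4"]) auto
qed

end

section \<open>Passing to large real parts\<close>

text \<open>The fixed point gives \<open>Er lam x = \<beta> * exp (x - \<beta>)\<close>, so the
  distance from \<open>\<beta>\<close> grows at least by the multiplier
  \<open>\<beta>\<close>.\<close>

lemma Er_ge_self:
  assumes "0 < lam" "lam * exp \<beta> = \<beta>" "1 < \<beta>" "\<beta> \<le> x"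
  shows "\<beta> * (x - \<beta>) \<le> Er lam x - \<beta>" "x \<le> Er lam x"
proof -
  have "Er lam x = \<beta> * exp (x - \<beta>)"
    using assms(2) Er_add[of lam \<beta> "x - \<beta>"] by (simp add: Er_def)
  moreover have "\<beta> * (1 + (x - \<beta>)) \<le> \<beta> * exp (x - \<beta>)"
    using assms by (intro mult_left_mono exp_ge_add_one_self) auto
  ultimately show 1: "\<beta> * (x - \<beta>) \<le> Er lam x - \<beta>" by (simp add: algebra_simps)
  have "1 * (x - \<beta>) \<le> \<beta> * (x - \<beta>)" using assms by (intro mult_right_mono) auto
  then show "x \<le> Er lam x" using 1 by simp
qed

lemma Er_funpow_unbounded:
  assumes "0 < lam" "lam * exp \<beta> = \<beta>" "1 < \<beta>" "\<beta> < x"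
  obtains j where "K \<le> (Er lam ^^ j) x"
proof -
  have 1: "\<beta> ^ j * (x - \<beta>) \<le> (Er lam ^^ j) x - \<beta>" for j
  proof (induction j)
    case (Suc j)
    have "0 \<le> \<beta> ^ j * (x - \<beta>)" using assms by simp
    then have y: "\<beta> \<le> (Er lam ^^ j) x" using Suc.IH by linarith
    have "\<beta> * (\<beta> ^ j * (x - \<beta>)) \<le> \<beta> * ((Er lam ^^ j) x - \<beta>)"
      using assms Suc.IH by (intro mult_left_mono) auto
    also have "\<dots> \<le> (Er lam ^^ Suc j) x - \<beta>" using Er_ge_self(1)[OF assms(1-3) y] by simp
    finally show ?case by (simp add: mult_ac)
  qed simp
  obtain j where "K / (x - \<beta>) < \<beta> ^ j" using real_arch_pow[OF assms(3)] by blast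
  then have "K < \<beta> ^ j * (x - \<beta>)" using assms(4) by (simp add: field_simps)
  then have "K \<le> (Er lam ^^ j) x" using 1[of j] assms(3) by linarith
  then show ?thesis by (rule that)
qed

lemma gauge_null_Xset_funpow_pullback:
  assumes fp: "0 < lam" "lam * exp \<beta> = \<beta>" "1 < \<beta>" and x: "\<beta> \<le> x"
    and mono: "mono_on {0<..<t0} h" and hpos: "\<forall>t\<in>{0<..<t0}. h t > 0"
    and null: "gauge_hausdorff h t0 (Xset lam ((Er lam ^^ j) x) psi) = 0"
  shows "gauge_hausdorff h t0 (Xset lam x psi) = 0"
  using x null
proof (induction j arbitrary: x)
  case (Suc j)
  have x: "x \<le> Er lam x" using Er_ge_self(2)[OF fp Suc.prems(1)] .
  have "(Er lam ^^ Suc j) x = (Er lam ^^ j) (Er lam x)" by (simp add: funpow_swap1)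
  then have "gauge_hausdorff h t0 (Xset lam ((Er lam ^^ j) (Er lam x)) psi) = 0"
    using Suc.prems(2) by (simp only:)
  with order.trans[OF Suc.prems(1) x] have null: "gauge_hausdorff h t0 (Xset lam (Er lam x) psi) = 0"
    by (rule Suc.IH)
  have "1 \<le> x" using fp(3) Suc.prems(1) by linarith
  from gauge_null_Xset_pullback[OF null fp(1) this x mono hpos] show ?case .
qed simp

lemma growth_powr_Suc_eventually:
  fixes lam \<delta> :: real
  assumes "0 < lam" "0 < \<delta>"
  shows "\<forall>\<^sub>F y in at_top. exp 2 * Er lam y * (y/2) powr (1 + \<delta>) \<le> (Er lam y / 2) powr (1 + \<delta>)"
  unfolding Er_def using assms by real_asymp

lemma growth_powr_eventually:
  fixes lam \<delta> C :: real
  assumes "0 < lam" "0 < \<delta>" "0 < C"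
  shows "\<forall>\<^sub>F u in at_top. 48 * C * u powr (1 + \<delta>) \<le> (Er lam u / 2) powr \<delta>"
  unfolding Er_def using assms by real_asymp

lemma gauge_dichotomy:
  fixes lam x0 \<beta> t0 \<delta> :: real and \<psi> p h :: "real \<Rightarrow> real"
  assumes lam: "0 < lam" "lam < 1" and beta: "lam * exp \<beta> = \<beta>" "1 < \<beta>" and x0: "\<beta> < x0"
    and mono: "mono \<psi>" and pos: "\<And>x. 0 < \<psi> x" and inf: "filterlim \<psi> at_top at_top"
    and dbl: "(\<lambda>x. \<psi> (2 * x)) \<in> O(\<psi>)" and small: "\<psi> \<in> o(\<lambda>x. x)"
    and t0: "0 < t0" and p_mono: "mono_on {1 / t0<..} p" and p_pos: "\<forall>s>1 / t0. p s > 0"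
    and tp_mono: "mono_on {0<..<t0} (\<lambda>t. t * p (1 / t))"
    and h_def: "\<forall>t\<in>{0<..<t0}. h t = t / p (1 / t)"
    and h_mono: "mono_on {0<..<t0} h" and h_pos: "\<forall>t\<in>{0<..<t0}. h t > 0"
    and h_lim: "(h \<longlongrightarrow> 0) (at_right 0)" and \<delta>: "0 < \<delta>"
  shows "(\<forall>\<^sub>F t in at_top. p (t * (ln t) powr (1 + \<delta>) / \<psi> t) \<le> \<psi> (ln t))
            \<Longrightarrow> gauge_hausdorff h t0 (Xset lam x0 \<psi>) = \<infinity>"
    and "(\<forall>\<^sub>F t in at_top. p (t * ln t / \<psi> t) \<ge> (ln t) powr (1 + \<delta>))
            \<Longrightarrow> gauge_hausdorff h t0 (Xset lam x0 \<psi>) = 0"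
proof -
  obtain C where strip: "\<forall>\<^sub>F a in at_top. exp_strip lam a C \<psi>"
    using exp_strip_eventually[OF lam mono pos inf dbl small] by blast
  then obtain a' where "exp_strip lam a' C \<psi>" by (auto dest!: eventually_happens)
  then have C: "1 \<le> C" by (rule exp_strip.C_ge)
  {
    assume hyp: "\<forall>\<^sub>F t in at_top. p (t * (ln t) powr (1 + \<delta>) / \<psi> t) \<le> \<psi> (ln t)"
    have "\<forall>\<^sub>F a in at_top. 2 * (4 * pi * C^2 * exp 3 * exp 2) \<le> \<psi> a"
      using inf by (auto simp: filterlim_at_top)
    with strip eventually_all_ge_at_top[OF hyp]
      eventually_all_ge_at_top[OF growth_powr_Suc_eventually[OF lam(1) \<delta>]]
      eventually_ge_at_top[of "2 * exp 2"] eventually_ge_at_top[of x0]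
    have "\<forall>\<^sub>F a in at_top. gauge_hausdorff h t0 (Xset lam a \<psi>) = \<infinity> \<and> x0 \<le> a"
    proof eventually_elim
      case (elim a)
      interpret exp_strip lam a C \<psi> by (rule elim)
      show ?case
        using elim gauge_infinite_Xset[OF t0 \<delta> h_def p_mono p_pos tp_mono h_pos h_lim]
        by (simp add: step_const_def)
    qed
    then obtain a where a: "gauge_hausdorff h t0 (Xset lam a \<psi>) = \<infinity>" "x0 \<le> a"
      by (auto dest!: eventually_happens)
    \<comment> \<open>A larger threshold gives a smaller set, so the infinite value passes to
      \<open>x0\<close>.\<close>
    have "gauge_hausdorff h t0 (Xset lam a \<psi>) \<le> gauge_hausdorff h t0 (Xset lam x0 \<psi>)"
      using lam(1) a(2) by (intro gauge_hausdorff_mono Xset_antimono)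
    then show "gauge_hausdorff h t0 (Xset lam x0 \<psi>) = \<infinity>" using a(1) by (simp add: top_unique)
  }
  {
    assume hyp: "\<forall>\<^sub>F t in at_top. p (t * ln t / \<psi> t) \<ge> (ln t) powr (1 + \<delta>)"
    define C5 where "C5 = 2 * (1 + 2 * C^2)"
    have C5: "0 < C5" by (simp add: C5_def add_pos_nonneg)
    define m where "m = min (1/2) (t0/2)"
    have m: "0 < m" "m \<le> 1/2" "m < t0" using t0 by (auto simp: m_def)
    have "\<forall>\<^sub>F t in at_top. norm (\<psi> t) \<le> (m / C5) * norm t"
      using m(1) C5 by (intro landau_o.smallD[OF small]) simp
    then have scale: "\<forall>\<^sub>F t in at_top. C5 * \<psi> t / t \<le> 1/2 \<and> C5 * \<psi> t / t < t0"
      using eventually_gt_at_top[of 0]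
    proof eventually_elim
      case (elim t)
      then have "C5 * \<psi> t / t \<le> m" using C5 pos[of t] by (simp add: field_simps)
      then show ?case using m by linarith
    qed
    have "\<forall>\<^sub>F t in at_top. norm (\<psi> t) \<le> 1 * norm t" by (intro landau_o.smallD[OF small]) simp
    moreover have "filterlim ln at_top (at_top :: real filter)" by (rule ln_at_top)
    then have "\<forall>\<^sub>F t in at_top. 1 / t0 < ln t" by (auto simp: filterlim_at_top_dense)
    ultimately have dom: "\<forall>\<^sub>F t in at_top. 1 / t0 < t * ln t / \<psi> t"
      using eventually_gt_at_top[of 0]
    proof eventually_elim
      case (elim t)
      have "0 < 1 / t0" using t0 by simp
      then have "0 \<le> ln t" using elim(2) by linarith
      moreover have "\<psi> t \<le> t" using elim(1,3) pos[of t] by simp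
      ultimately have "ln t * \<psi> t \<le> ln t * t" by (rule mult_left_mono[rotated])
      then have "ln t \<le> t * ln t / \<psi> t" using pos[of t] by (simp add: field_simps)
      then show ?case using elim(2) by linarith
    qed
    from hyp dom have "\<forall>\<^sub>F t in at_top. ln t powr (1 + \<delta>) \<le> p (t * ln t / \<psi> t) \<and> 1 / t0 < t * ln t / \<psi> t"
      by (rule eventually_conj)
    moreover have "0 < C" using C by simp
    from strip eventually_all_ge_at_top[OF calculation] eventually_all_ge_at_top[OF scale]
      eventually_all_ge_at_top[OF growth_powr_eventually[OF lam(1) \<delta> this]]
    have "\<forall>\<^sub>F a in at_top. gauge_hausdorff h t0 (Xset lam a \<psi>) = 0"
    proof eventually_elim
      case (elim a)
      interpret exp_strip lam a C \<psi> by (rule elim)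
      show ?case
        using elim C by (intro gauge_null_Xset[OF C5_def t0 \<delta> h_def p_mono p_pos tp_mono h_mono h_pos]) auto
    qed
    then obtain K where K: "\<And>a. K \<le> a \<Longrightarrow> gauge_hausdorff h t0 (Xset lam a \<psi>) = 0"
      by (auto simp: eventually_at_top_linorder)
    \<comment> \<open>Nullity does not pass to larger sets by inclusion; the threshold is moved up
      along the orbit of \<open>x0\<close> and the null set is pulled back.\<close>
    obtain j where "K \<le> (Er lam ^^ j) x0" by (rule Er_funpow_unbounded[OF lam(1) beta x0])
    then show "gauge_hausdorff h t0 (Xset lam x0 \<psi>) = 0"
      using x0 by (intro gauge_null_Xset_funpow_pullback[OF lam(1) beta _ h_mono h_pos K]) auto
  }
qed

theorem theorem1p3:
  fixes lam x0 \<beta> t0 \<delta> :: real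
    and \<psi> p h :: "real \<Rightarrow> real"
  assumes lam_pos: "0 < lam" and lam_lt: "lam < 1 / exp 1"
    and beta_fix: "lam * exp \<beta> = \<beta>" and beta_gt: "1 < \<beta>"
    and x0_gt: "x0 > \<beta>"
    and psi_mono: "mono_on {x0..} \<psi>"
    and psi_pos: "\<forall>x\<ge>x0. \<psi> x > 0"
    and psi_inf: "filterlim \<psi> at_top at_top"
    and psi_doubling: "(\<lambda>x. \<psi> (2 * x)) \<in> O(\<psi>)"
    and psi_small: "\<psi> \<in> o(\<lambda>x. x)"
    and t0_pos: "0 < t0"
    and p_mono: "mono_on {1 / t0<..} p"
    and p_pos: "\<forall>s>1 / t0. p s > 0"
    and tp_mono: "mono_on {0<..<t0} (\<lambda>t. t * p (1 / t))"
    and h_def: "\<forall>t\<in>{0<..<t0}. h t = t / p (1 / t)"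
    and h_mono: "mono_on {0<..<t0} h"
    and h_cont: "continuous_on {0<..<t0} h"
    and h_pos: "\<forall>t\<in>{0<..<t0}. h t > 0"
    and h_lim: "(h \<longlongrightarrow> 0) (at_right 0)"
    and delta_pos: "0 < \<delta>"
  shows "((\<forall>\<^sub>F t in at_top. p (t * (ln t) powr (1 + \<delta>) / \<psi> t) \<le> \<psi> (ln t))
            \<longrightarrow> gauge_hausdorff h t0 (Xset lam x0 \<psi>) = \<infinity>)
       \<and> ((\<forall>\<^sub>F t in at_top. p (t * ln t / \<psi> t) \<ge> (ln t) powr (1 + \<delta>))
            \<longrightarrow> gauge_hausdorff h t0 (Xset lam x0 \<psi>) = 0)"
proof -
  \<comment> \<open>The general argument wants a function monotone and positive on the whole line; a
    constant extension to the left of \<open>x0\<close> changes neither the set nor the asymptotic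
    hypotheses.\<close>
  define \<phi> where "\<phi> x = \<psi> (max x0 x)" for x
  have eq: "\<phi> x = \<psi> x" if "x0 \<le> x" for x using that by (simp add: \<phi>_def max_def)
  have ev: "\<forall>\<^sub>F x in at_top. \<phi> x = \<psi> x"
    using eventually_ge_at_top[of x0] by eventually_elim (rule eq)
  have ev2: "\<forall>\<^sub>F x in at_top. \<phi> (2 * x) = \<psi> (2 * x)"
    using eventually_ge_at_top[of "x0/2"] by eventually_elim (rule eq, simp)
  have evln: "\<forall>\<^sub>F x in at_top. \<phi> (ln x) = \<psi> (ln x)"
    using ev ln_at_top by (rule eventually_compose_filterlim)
  have "Omega x0 \<phi> = Omega x0 \<psi>" by (auto simp: Omega_def eq)
  then have X: "Xset lam x0 \<phi> = Xset lam x0 \<psi>" by (simp add: Xset_def)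
  have lam1: "lam < 1" using lam_lt by (rule less_trans) (simp add: field_simps)
  have mono: "mono \<phi>"
    unfolding \<phi>_def by (intro monoI mono_onD[OF psi_mono]) auto
  have pos: "0 < \<phi> x" for x using psi_pos by (simp add: \<phi>_def)
  have inf: "filterlim \<phi> at_top at_top"
    using psi_inf filterlim_cong[OF refl refl ev] by simp
  have dbl: "(\<lambda>x. \<phi> (2 * x)) \<in> O(\<phi>)"
    using psi_doubling landau_o.big.in_cong[OF ev2] landau_o.big.cong[OF ev] by simp
  have small: "\<phi> \<in> o(\<lambda>x. x)"
    using psi_small landau_o.small.in_cong[OF ev] by simp
  note main = gauge_dichotomy[OF lam_pos lam1 beta_fix beta_gt x0_gt mono pos inf dbl small t0_pos
      p_mono p_pos tp_mono h_def h_mono h_pos h_lim delta_pos, unfolded X]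
  show ?thesis
  proof (intro conjI impI)
    assume "\<forall>\<^sub>F t in at_top. p (t * (ln t) powr (1 + \<delta>) / \<psi> t) \<le> \<psi> (ln t)"
    with ev evln have "\<forall>\<^sub>F t in at_top. p (t * (ln t) powr (1 + \<delta>) / \<phi> t) \<le> \<phi> (ln t)"
      by eventually_elim simp
    then show "gauge_hausdorff h t0 (Xset lam x0 \<psi>) = \<infinity>" by (rule main(1))
  next
    assume "\<forall>\<^sub>F t in at_top. p (t * ln t / \<psi> t) \<ge> (ln t) powr (1 + \<delta>)"
    with ev have "\<forall>\<^sub>F t in at_top. p (t * ln t / \<phi> t) \<ge> (ln t) powr (1 + \<delta>)"
      by eventually_elim simp
    then show "gauge_hausdorff h t0 (Xset lam x0 \<psi>) = 0" by (rule main(2))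
  qed
qed

end
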